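(* Let $X$ be a nonempty finitely generated rack. Then $X$ is medial and commutative if and only if there exist nonnegative integers $r,n,m_1,\dots,m_n\geq 0$ and a rack isomorphism $$X\cong (\mathbb{D}^r)_{\mathrm{mid}}\oplus\bigoplus_{i=1}^n C_{2m_i+1}.$$ In particular, every nonempty finite medial commutative rack is isomorphic to a direct sum of cyclic midpoint quandles $C_{2m_i+1}$.
   Context: A magma $(X,\ast)$ is a set with a binary operation. For $x\in X$, let $R_x\colon y\mapsto y\ast x$. A rack is a magma in which every $R_x$ is an automorphism of the magma (a bijective map preserving $\ast$). Rack homomorphisms are maps preserving $\ast$. A rack is finitely generated if it is generated by a finite subset under the operations $(x,y)\mapsto x\ast y$ and $(x,y)\mapsto R_y^{-1}(x)$. A quandle is a rack with $x\ast x=x$ for all $x$. A magma is medial if $(a\ast b)\ast(c\ast d)=(a\ast c)\ast(b\ast d)$ for all $a,b,c,d$, and commutative if $x\ast y=y\ast x$ for all $x,y$. $\mathbb{D}:=\mathbb{Z}[1/2]$. For a $\mathbb{D}$-module $M$, the midpoint quandle $M_{\mathrm{mid}}$ is the set $M$ with operation $x\ast y:=\frac12(x+y)$. For $m\ge 0$, the cyclic midpoint quandle of order $2m+1$ is $C_{2m+1}:=(\mathbb{Z}/(2m+1))_{\mathrm{mid}}$, where $\mathbb{Z}/(2m+1)$ is regarded as a $\mathbb{D}$-module (2 acts invertibly). The (finite) direct sum $\oplus$ of quandles is the Cartesian product with the componentwise operation; the empty direct sum is the one-element quandle. *)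

theory Defs
  imports "HOL-Algebra.Module" "HOL-Number_Theory.Residues"
begin

section \<open>Magmas and racks\<close>

record 'a magma = "'a partial_object" +
  mop :: "['a, 'a] \<Rightarrow> 'a" (infixl \<open>\<star>\<index>\<close> 70)

locale magma = fixes X (structure)
  assumes mop_closed: "\<lbrakk>x \<in> carrier X; y \<in> carrier X\<rbrakk> \<Longrightarrow> x \<star> y \<in> carrier X"

definition right_translation :: "('a, 'b) magma_scheme \<Rightarrow> 'a \<Rightarrow> 'a \<Rightarrow> 'a" where
  "right_translation X x = (\<lambda>y. y \<star>\<^bsub>X\<^esub> x)"

definition magma_hom :: "('a, 'c) magma_scheme \<Rightarrow> ('b, 'd) magma_scheme \<Rightarrow> ('a \<Rightarrow> 'b) set" where
  "magma_hom X Y = {h \<in> carrier X \<rightarrow> carrier Y.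
     \<forall>x\<in>carrier X. \<forall>y\<in>carrier X. h (x \<star>\<^bsub>X\<^esub> y) = h x \<star>\<^bsub>Y\<^esub> h y}"

definition magma_iso :: "('a, 'c) magma_scheme \<Rightarrow> ('b, 'd) magma_scheme \<Rightarrow> ('a \<Rightarrow> 'b) set" where
  "magma_iso X Y = {h \<in> magma_hom X Y. bij_betw h (carrier X) (carrier Y)}"

locale rack = magma +
  assumes right_translation_auto: "x \<in> carrier X \<Longrightarrow> right_translation X x \<in> magma_iso X X"

definition rack_isomorphic :: "('a, 'c) magma_scheme \<Rightarrow> ('b, 'd) magma_scheme \<Rightarrow> bool" where
  "rack_isomorphic X Y \<longleftrightarrow> magma_iso X Y \<noteq> {}"

inductive_set rack_generated :: "('a, 'b) magma_scheme \<Rightarrow> 'a set \<Rightarrow> 'a set"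
  for X (structure) and S where
    incl: "x \<in> S \<Longrightarrow> x \<in> rack_generated X S"
  | op: "\<lbrakk>x \<in> rack_generated X S; y \<in> rack_generated X S\<rbrakk> \<Longrightarrow> x \<star> y \<in> rack_generated X S"
  | inv_op: "\<lbrakk>x \<in> rack_generated X S; y \<in> rack_generated X S\<rbrakk> \<Longrightarrow>
      inv_into (carrier X) (right_translation X y) x \<in> rack_generated X S"

definition finitely_generated_rack :: "('a, 'b) magma_scheme \<Rightarrow> bool" where
  "finitely_generated_rack X \<longleftrightarrow>
     (\<exists>S. finite S \<and> S \<subseteq> carrier X \<and> rack_generated X S = carrier X)"

definition medial :: "('a, 'b) magma_scheme \<Rightarrow> bool" where
  "medial X \<longleftrightarrow> (\<forall>a\<in>carrier X. \<forall>b\<in>carrier X. \<forall>c\<in>carrier X. \<forall>d\<in>carrier X.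
     (a \<star>\<^bsub>X\<^esub> b) \<star>\<^bsub>X\<^esub> (c \<star>\<^bsub>X\<^esub> d) = (a \<star>\<^bsub>X\<^esub> c) \<star>\<^bsub>X\<^esub> (b \<star>\<^bsub>X\<^esub> d))"

definition commutative :: "('a, 'b) magma_scheme \<Rightarrow> bool" where
  "commutative X \<longleftrightarrow> (\<forall>x\<in>carrier X. \<forall>y\<in>carrier X. x \<star>\<^bsub>X\<^esub> y = y \<star>\<^bsub>X\<^esub> x)"

definition direct_sum2 :: "('a, 'c) magma_scheme \<Rightarrow> ('b, 'd) magma_scheme \<Rightarrow> ('a \<times> 'b) magma" where
  "direct_sum2 X Y = \<lparr>carrier = carrier X \<times> carrier Y,
     mop = \<lambda>p q. (fst p \<star>\<^bsub>X\<^esub> fst q, snd p \<star>\<^bsub>Y\<^esub> snd q)\<rparr>"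

definition direct_sum :: "'i set \<Rightarrow> ('i \<Rightarrow> ('a, 'c) magma_scheme) \<Rightarrow> ('i \<Rightarrow> 'a) magma" where
  "direct_sum I X = \<lparr>carrier = (\<Pi>\<^sub>E i\<in>I. carrier (X i)),
     mop = \<lambda>x y. \<lambda>i\<in>I. x i \<star>\<^bsub>X i\<^esub> y i\<rparr>"


section \<open>Modules over the ring of dyadic rationals\<close>

definition dyadic_ring :: "rat ring" where
  "dyadic_ring = \<lparr>carrier = {of_int a / 2 ^ k |a k. True},
     monoid.mult = (*), one = 1, zero = 0, add = (+)\<rparr>"

definition midpoint_quandle :: "(rat, 'a) module \<Rightarrow> 'a magma" where
  "midpoint_quandle M = \<lparr>carrier = carrier M, mop = \<lambda>x y. (1/2) \<odot>\<^bsub>M\<^esub> (x \<oplus>\<^bsub>M\<^esub> y)\<rparr>"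

text \<open>The fields \<open>mult\<close> and \<open>one\<close> of a module record play no role in the module structure.\<close>

definition dyadic_free_module :: "nat \<Rightarrow> (rat, nat \<Rightarrow> rat) module" where
  "dyadic_free_module r = \<lparr>carrier = {1..r} \<rightarrow>\<^sub>E carrier dyadic_ring,
     monoid.mult = undefined, one = undefined,
     zero = (\<lambda>i\<in>{1..r}. 0),
     add = (\<lambda>x y. \<lambda>i\<in>{1..r}. x i + y i),
     smult = (\<lambda>d x. \<lambda>i\<in>{1..r}. d * x i)\<rparr>"

text \<open>For odd \<open>N\<close> and a dyadic rational \<open>d = p / q\<close> in lowest terms, \<open>q\<close> is a power of 2 and hence
  acts invertibly on the residues modulo \<open>N\<close>; so \<open>d \<odot> x\<close> is the unique \<open>y\<close> with \<open>q y = p x\<close>.\<close>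

definition dyadic_residue_module :: "nat \<Rightarrow> (rat, int) module" where
  "dyadic_residue_module N = \<lparr>carrier = carrier (residue_ring (int N)),
     monoid.mult = monoid.mult (residue_ring (int N)), one = one (residue_ring (int N)),
     zero = zero (residue_ring (int N)), add = add (residue_ring (int N)),
     smult = (\<lambda>d x. THE y. y \<in> carrier (residue_ring (int N)) \<and>
        [snd (quotient_of d) * y = fst (quotient_of d) * x] (mod int N))\<rparr>"

definition cyclic_midpoint_quandle :: "nat \<Rightarrow> int magma" where
  "cyclic_midpoint_quandle N = midpoint_quandle (dyadic_residue_module N)"


section \<open>The structures above are modules\<close>

lemma dyadic_carrier_iff: "d \<in> carrier dyadic_ring \<longleftrightarrow> (\<exists>a k. d = of_int a / 2 ^ k)"
  by (simp add: dyadic_ring_def)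

lemma dyadic_add:
  assumes "x \<in> carrier dyadic_ring" "y \<in> carrier dyadic_ring"
  shows "x + y \<in> carrier dyadic_ring"
proof -
  obtain a k b l where "x = of_int a / 2 ^ k" "y = of_int b / 2 ^ l"
    using assms dyadic_carrier_iff by metis
  then have "x + y = of_int (a * 2 ^ l + b * 2 ^ k) / 2 ^ (k + l)"
    by (simp add: add_divide_distrib power_add)
  then show ?thesis unfolding dyadic_carrier_iff by blast
qed

lemma dyadic_mult:
  assumes "x \<in> carrier dyadic_ring" "y \<in> carrier dyadic_ring"
  shows "x * y \<in> carrier dyadic_ring"
proof -
  obtain a k b l where "x = of_int a / 2 ^ k" "y = of_int b / 2 ^ l"
    using assms dyadic_carrier_iff by metis
  then have "x * y = of_int (a * b) / 2 ^ (k + l)"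
    by (simp add: power_add)
  then show ?thesis unfolding dyadic_carrier_iff by blast
qed

lemma dyadic_of_int: "of_int a \<in> carrier dyadic_ring"
  unfolding dyadic_carrier_iff by (rule exI[of _ a], rule exI[of _ 0]) simp

lemma dyadic_uminus: "x \<in> carrier dyadic_ring \<Longrightarrow> - x \<in> carrier dyadic_ring"
  using dyadic_mult[OF dyadic_of_int[of "-1"]] by simp

lemma dyadic_half: "1 / 2 \<in> carrier dyadic_ring"
  unfolding dyadic_carrier_iff by (rule exI[of _ 1], rule exI[of _ 1]) simp

lemma dyadic_ring_simps [simp]:
  "x \<oplus>\<^bsub>dyadic_ring\<^esub> y = x + y" "x \<otimes>\<^bsub>dyadic_ring\<^esub> y = x * y"
  "\<zero>\<^bsub>dyadic_ring\<^esub> = 0" "\<one>\<^bsub>dyadic_ring\<^esub> = 1"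
  by (simp_all add: dyadic_ring_def)

lemma cring_dyadic_ring: "cring dyadic_ring"
proof (intro cringI abelian_groupI comm_monoidI)
  fix x assume "x \<in> carrier dyadic_ring"
  then show "\<exists>y\<in>carrier dyadic_ring. y \<oplus>\<^bsub>dyadic_ring\<^esub> x = \<zero>\<^bsub>dyadic_ring\<^esub>"
    by (intro bexI[of _ "- x"]) (auto intro: dyadic_uminus)
qed (use dyadic_of_int[of 0] dyadic_of_int[of 1] in
      \<open>auto simp: algebra_simps intro: dyadic_add dyadic_mult\<close>)

lemma module_dyadic_free_module: "module dyadic_ring (dyadic_free_module r)"
proof (intro moduleI abelian_groupI cring_dyadic_ring)
  fix x assume "x \<in> carrier (dyadic_free_module r)"
  then show "\<exists>y\<in>carrier (dyadic_free_module r).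
      y \<oplus>\<^bsub>dyadic_free_module r\<^esub> x = \<zero>\<^bsub>dyadic_free_module r\<^esub>"
    by (intro bexI[of _ "\<lambda>i\<in>{1..r}. - x i"])
       (auto simp: dyadic_free_module_def intro!: dyadic_uminus)
qed (use dyadic_of_int[of 0] in \<open>auto simp: dyadic_free_module_def algebra_simps restrict_def PiE_def
        extensional_def fun_eq_iff Pi_iff intro!: dyadic_add dyadic_mult\<close>)

lemma dyadic_residue_smult_eqI:
  assumes N: "odd N" and y: "y \<in> {0..<int N}" and "[2 ^ k * y = a * x] (mod int N)"
  shows "(of_int a / 2 ^ k) \<odot>\<^bsub>dyadic_residue_module N\<^esub> x = y"
proof -
  define d :: rat where "d = of_int a / 2 ^ k"
  obtain p q where pq: "quotient_of d = (p, q)" by fastforce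
  then have q0: "q > 0" and "coprime p q" and d: "d = of_int p / of_int q"
    by (auto simp: quotient_of_denom_pos quotient_of_coprime quotient_of_div)
  have "(of_int (a * q) :: rat) = of_int (p * 2 ^ k)"
    using d q0 unfolding d_def by (simp add: field_simps)
  then have eq: "a * q = p * 2 ^ k" by (simp only: of_int_eq_iff)
  then have "q dvd p * 2 ^ k" by (metis dvd_triv_right)
  with \<open>coprime p q\<close> have "q dvd 2 ^ k"
    by (simp add: coprime_commute coprime_dvd_mult_right_iff)
  moreover have c2: "coprime (2 ^ k) (int N)" using N by simp
  ultimately have cq: "coprime q (int N)" by (meson coprime_divisors dvd_refl)
  have "[2 ^ k * (q * y) = 2 ^ k * (p * x)] (mod int N)"
  proof -
    have "[q * (2 ^ k * y) = q * (a * x)] (mod int N)" using assms(3) by (rule cong_scalar_left)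
    moreover have "q * (a * x) = 2 ^ k * (p * x)" using arg_cong[OF eq, of "\<lambda>t. t * x"] by (simp only: mult_ac)
    moreover have "q * (2 ^ k * y) = 2 ^ k * (q * y)" by (simp only: mult_ac)
    ultimately show ?thesis by (simp only:)
  qed
  then have qy: "[q * y = p * x] (mod int N)" using c2 by (simp add: cong_mult_lcancel)
  have "(THE z. z \<in> {0..int N - 1} \<and> [q * z = p * x] (mod int N)) = y"
  proof (rule the_equality)
    fix z assume z: "z \<in> {0..int N - 1} \<and> [q * z = p * x] (mod int N)"
    then have "[q * z = q * y] (mod int N)" using qy cong_sym cong_trans by blast
    then have "[z = y] (mod int N)" using cq by (simp add: cong_mult_lcancel)
    with z y show "z = y" by (simp add: cong_def)
  qed (use y qy in auto)
  then show ?thesis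
    unfolding d_def[symmetric] by (simp add: dyadic_residue_module_def residue_ring_def pq)
qed

lemma cong_two_mult_half:
  assumes "odd N"
  shows "[2 * ((int N + 1) div 2) = 1] (mod int N)"
proof -
  have "2 * ((int N + 1) div 2) = int N + 1"
    using assms by (intro dvd_mult_div_cancel) simp
  then show ?thesis by (simp only:) (simp add: cong_def)
qed

lemma dyadic_residue_smult:
  assumes N: "odd N"
  shows "(of_int a / 2 ^ k) \<odot>\<^bsub>dyadic_residue_module N\<^esub> x = (a * ((int N + 1) div 2) ^ k * x) mod int N"
proof (rule dyadic_residue_smult_eqI[OF N])
  have "[2 * ((int N + 1) div 2) = 1] (mod int N)" by (rule cong_two_mult_half[OF N])
  then have "[(2 * ((int N + 1) div 2)) ^ k * (a * x) = 1 ^ k * (a * x)] (mod int N)"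
    by (intro cong_mult cong_pow) auto
  then show "[2 ^ k * ((a * ((int N + 1) div 2) ^ k * x) mod int N) = a * x] (mod int N)"
    by (simp add: cong_def mod_simps power_mult_distrib algebra_simps)
next
  show "(a * ((int N + 1) div 2) ^ k * x) mod int N \<in> {0..<int N}"
    using odd_pos[OF N] by auto
qed

lemma module_dyadic_residue_module:
  assumes N: "odd N"
  shows "module dyadic_ring (dyadic_residue_module N)"
proof -
  let ?M = "dyadic_residue_module N"
  have N0: "int N > 0" using odd_pos[OF N] by simp
  have carr: "carrier ?M = {0..<int N}" and add: "\<And>x y. x \<oplus>\<^bsub>?M\<^esub> y = (x + y) mod int N"
    and zero: "\<zero>\<^bsub>?M\<^esub> = 0"
    by (auto simp: dyadic_residue_module_def residue_ring_def)
  define h where "h = (int N + 1) div 2"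
  have h: "[2 * h = 1] (mod int N)" unfolding h_def by (rule cong_two_mult_half[OF N])
  note sm = dyadic_residue_smult[OF N, folded h_def]
  show ?thesis
  proof (intro moduleI abelian_groupI cring_dyadic_ring)
    fix x assume "x \<in> carrier ?M"
    then show "\<exists>y\<in>carrier ?M. y \<oplus>\<^bsub>?M\<^esub> x = \<zero>\<^bsub>?M\<^esub>"
      using N0 by (intro bexI[of _ "(- x) mod int N"]) (auto simp: carr add zero mod_simps)
  next
    fix d x assume "d \<in> carrier dyadic_ring" "x \<in> carrier ?M"
    then show "d \<odot>\<^bsub>?M\<^esub> x \<in> carrier ?M"
      using N0 by (auto simp: dyadic_carrier_iff sm carr)
  next
    fix d e x assume "d \<in> carrier dyadic_ring" "e \<in> carrier dyadic_ring" "x \<in> carrier ?M"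
    then obtain a k b l where d: "d = of_int a / 2 ^ k" and e: "e = of_int b / 2 ^ l"
      using dyadic_carrier_iff by metis
    have de: "d + e = of_int (a * 2 ^ l + b * 2 ^ k) / 2 ^ (k + l)"
      unfolding d e by (simp add: add_divide_distrib power_add)
    have A: "[(2 * h) ^ l * (a * h ^ k * x) + (2 * h) ^ k * (b * h ^ l * x)
        = 1 ^ l * (a * h ^ k * x) + 1 ^ k * (b * h ^ l * x)] (mod int N)"
      by (intro cong_add cong_mult cong_pow h cong_refl)
    have "(d + e) \<odot>\<^bsub>?M\<^esub> x = ((2 * h) ^ l * (a * h ^ k * x) + (2 * h) ^ k * (b * h ^ l * x)) mod int N"
      unfolding de sm by (simp add: power_add power_mult_distrib algebra_simps)
    then show "(d \<oplus>\<^bsub>dyadic_ring\<^esub> e) \<odot>\<^bsub>?M\<^esub> x = d \<odot>\<^bsub>?M\<^esub> x \<oplus>\<^bsub>?M\<^esub> e \<odot>\<^bsub>?M\<^esub> x"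
      using A unfolding d e by (simp add: sm add mod_simps cong_def)
    have "d * e = of_int (a * b) / 2 ^ (k + l)"
      unfolding d e by (simp add: power_add)
    then have "(d * e) \<odot>\<^bsub>?M\<^esub> x = (a * b * h ^ (k + l) * x) mod int N"
      by (simp only: sm)
    also have "\<dots> = ((a * h ^ k) * (b * h ^ l * x)) mod int N"
      by (simp add: power_add algebra_simps)
    also have "\<dots> = ((a * h ^ k) * ((b * h ^ l * x) mod int N)) mod int N"
      by (simp only: mod_mult_right_eq)
    also have "\<dots> = d \<odot>\<^bsub>?M\<^esub> (e \<odot>\<^bsub>?M\<^esub> x)"
      unfolding d e by (simp only: sm)
    finally show "(d \<otimes>\<^bsub>dyadic_ring\<^esub> e) \<odot>\<^bsub>?M\<^esub> x = d \<odot>\<^bsub>?M\<^esub> (e \<odot>\<^bsub>?M\<^esub> x)"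
      by simp
  next
    fix d x y assume "d \<in> carrier dyadic_ring"
    then obtain a k where d: "d = of_int a / 2 ^ k" using dyadic_carrier_iff by metis
    show "d \<odot>\<^bsub>?M\<^esub> (x \<oplus>\<^bsub>?M\<^esub> y) = d \<odot>\<^bsub>?M\<^esub> x \<oplus>\<^bsub>?M\<^esub> d \<odot>\<^bsub>?M\<^esub> y"
      unfolding d sm add by (simp add: mod_simps) (simp add: algebra_simps)
  next
    fix x assume "x \<in> carrier ?M"
    then show "\<one>\<^bsub>dyadic_ring\<^esub> \<odot>\<^bsub>?M\<^esub> x = x"
      using sm[of 1 0 x] by (simp add: carr)
  qed (use N0 in \<open>auto simp: carr add zero mod_simps algebra_simps\<close>)
qed

end

theory Submission
  imports Defs
begin

text \<open>
  A medial commutative rack is the same thing as a \<open>\<int>[1/2]\<close>-module that has forgotten its zero.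
  In a commutative rack, distributivity of the right translations gives
  \<open>x * (x * x) = (x * x) * (x * x)\<close>, and cancelling yields \<open>x * x = x\<close>. After a base point \<open>e\<close> is
  chosen, let \<open>a + b\<close> be the unique element with \<open>(a + b) * e = a * b\<close>. Mediality makes this
  addition associative, idempotence makes \<open>x \<mapsto> x * e\<close> the inverse of doubling, so the
  rack becomes a uniquely 2-divisible abelian group, hence a module over the dyadic rationals, and
  its operation is \<open>a * b = 1/2 (a + b)\<close> (\<open>midpoint_pointed_module\<close>). The inverse operation
  \<open>2 x - y\<close> is linear as well, so rack generators generate the module
  (\<open>rack_generated_subset_span\<close>).

  It remains to write a finitely generated module over \<open>\<int>[1/2]\<close> as a direct sum of cyclic ones.
  The argument is Rado's proof for abelian groups: a relation \<open>p x = q y\<close> between generators with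
  integer coefficients can be replaced, by a unimodular change of the generators, with
  \<open>gcd p q\<close> times a single new generator being zero. A generator whose torsion order is minimal
  among all generating families of the given length therefore satisfies no nontrivial relation with
  the others (\<open>split_off_generator\<close>), and induction gives an independent family. Working over
  \<open>\<int>[1/2]\<close> causes no trouble since powers of 2 are units: denominators are absorbed into the
  generators. An independent generator that is torsion free contributes a copy of \<open>\<int>[1/2]\<close>; one
  of order \<open>N\<close>, necessarily odd, contributes \<open>\<int>/N\<close>.

  Conversely, midpoints in a module satisfy both identities, and these pass to direct sums and along
  isomorphisms. A finite rack generates itself, and in its decomposition the rank of the free part
  is 0 because \<open>\<int>[1/2]\<close> is infinite.
\<close>

section \<open>Uniquely 2-divisible groups as dyadic modules\<close>

text \<open>The value is meant to be the solution \<open>y\<close> of \<open>2\<^sup>k y = a x\<close>, for whichever way of writing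
  \<open>d = a / 2\<^sup>k\<close>. In a uniquely 2-divisible group the solution exists, and by cross-multiplication
  it is the same for all of them.\<close>
definition dyadic_action :: "('a, 'b) ring_scheme \<Rightarrow> rat \<Rightarrow> 'a \<Rightarrow> 'a" where
  "dyadic_action G d x = (THE y. y \<in> carrier G \<and>
     (\<exists>(a::int) (k::nat). d = of_int a / 2 ^ k \<and> [(2 ^ k :: int)] \<cdot>\<^bsub>G\<^esub> y = [a] \<cdot>\<^bsub>G\<^esub> x))"

locale uniquely_2_divisible_group = abelian_group G for G (structure) +
  assumes bij_double: "bij_betw (\<lambda>x. x \<oplus> x) (carrier G) (carrier G)"
begin

lemma int_mult_add: "x \<in> carrier G \<Longrightarrow> [(i + j)] \<cdot>\<^bsub>G\<^esub> x = [(i::int)] \<cdot>\<^bsub>G\<^esub> x \<oplus> [(j::int)] \<cdot>\<^bsub>G\<^esub> x"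
  using add.int_pow_mult by simp

lemma int_mult_mult: "x \<in> carrier G \<Longrightarrow> [(i * j)] \<cdot>\<^bsub>G\<^esub> x = [(i::int)] \<cdot>\<^bsub>G\<^esub> ([(j::int)] \<cdot>\<^bsub>G\<^esub> x)"
  using add.int_pow_pow[of x i j] by (simp add: mult.commute[of j i])

lemma int_mult_distrib:
  "\<lbrakk>x \<in> carrier G; y \<in> carrier G\<rbrakk> \<Longrightarrow> [(i::int)] \<cdot>\<^bsub>G\<^esub> (x \<oplus> y) = [i] \<cdot>\<^bsub>G\<^esub> x \<oplus> [i] \<cdot>\<^bsub>G\<^esub> y"
  using add.int_pow_distrib by simp

lemma int_mult_closed: "x \<in> carrier G \<Longrightarrow> [(i::int)] \<cdot>\<^bsub>G\<^esub> x \<in> carrier G"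
  using add.int_pow_closed by simp

lemma int_mult_one: "x \<in> carrier G \<Longrightarrow> [(1::int)] \<cdot>\<^bsub>G\<^esub> x = x"
  using add.int_pow_1 by simp

lemma bij_pow2: "bij_betw (\<lambda>x. [(2 ^ k :: int)] \<cdot>\<^bsub>G\<^esub> x) (carrier G) (carrier G)"
proof (induction k)
  case 0
  have "bij_betw id (carrier G) (carrier G)" by simp
  then show ?case by (rule bij_betw_cong[THEN iffD1, rotated]) (simp add: int_mult_one)
next
  case (Suc k)
  have "bij_betw ((\<lambda>x. [(2 ^ k :: int)] \<cdot>\<^bsub>G\<^esub> x) \<circ> (\<lambda>x. x \<oplus> x)) (carrier G) (carrier G)"
    by (rule bij_betw_trans[OF bij_double Suc])
  then show ?case
  proof (rule bij_betw_cong[THEN iffD1, rotated])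
    fix x assume x: "x \<in> carrier G"
    have "[(2 ^ k + 2 ^ k :: int)] \<cdot>\<^bsub>G\<^esub> x = [(2 ^ k :: int)] \<cdot>\<^bsub>G\<^esub> (x \<oplus> x)"
      using x by (simp only: int_mult_add int_mult_distrib)
    then show "((\<lambda>x. [(2 ^ k :: int)] \<cdot>\<^bsub>G\<^esub> x) \<circ> (\<lambda>x. x \<oplus> x)) x = [(2 ^ Suc k :: int)] \<cdot>\<^bsub>G\<^esub> x"
      by simp
  qed
qed

lemma pow2_cancel:
  assumes "[(2 ^ k :: int)] \<cdot>\<^bsub>G\<^esub> x = [(2 ^ k :: int)] \<cdot>\<^bsub>G\<^esub> y" "x \<in> carrier G" "y \<in> carrier G"
  shows "x = y"
  using bij_pow2[of k] assms unfolding bij_betw_def inj_on_def by blast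

text \<open>Two representations \<open>a / 2\<^sup>k = b / 2\<^sup>l\<close> satisfy \<open>2\<^sup>l a = 2\<^sup>k b\<close>, so the solutions for both agree
  after multiplication by \<open>2 ^ (k + l)\<close>, which is injective.\<close>
lemma dyadic_action_eqI:
  assumes x: "x \<in> carrier G" and y: "y \<in> carrier G"
    and eq: "[(2 ^ k :: int)] \<cdot>\<^bsub>G\<^esub> y = [(a::int)] \<cdot>\<^bsub>G\<^esub> x"
  shows "dyadic_action G (of_int a / 2 ^ k) x = y"
  unfolding dyadic_action_def
proof (rule the_equality)
  show "y \<in> carrier G \<and> (\<exists>(b::int) (l::nat). (of_int a / 2 ^ k :: rat) = of_int b / 2 ^ l
      \<and> [(2 ^ l :: int)] \<cdot>\<^bsub>G\<^esub> y = [b] \<cdot>\<^bsub>G\<^esub> x)"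
    using y eq by blast
next
  fix z
  assume "z \<in> carrier G \<and> (\<exists>(b::int) (l::nat). (of_int a / 2 ^ k :: rat) = of_int b / 2 ^ l
      \<and> [(2 ^ l :: int)] \<cdot>\<^bsub>G\<^esub> z = [b] \<cdot>\<^bsub>G\<^esub> x)"
  then obtain b :: int and l :: nat where z: "z \<in> carrier G"
    and ab: "(of_int a / 2 ^ k :: rat) = of_int b / 2 ^ l"
    and zl: "[(2 ^ l :: int)] \<cdot>\<^bsub>G\<^esub> z = [b] \<cdot>\<^bsub>G\<^esub> x" by blast
  have "(of_int (a * 2 ^ l) :: rat) = of_int (b * 2 ^ k)"
    using ab by (simp add: field_simps)
  then have int_ab: "2 ^ l * a = 2 ^ k * b" by (simp only: of_int_eq_iff mult.commute)
  have "[(2 ^ (l + k) :: int)] \<cdot>\<^bsub>G\<^esub> z = [(2 ^ k * 2 ^ l :: int)] \<cdot>\<^bsub>G\<^esub> z" by (simp add: power_add mult.commute)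
  also have "\<dots> = [(2 ^ l * a)] \<cdot>\<^bsub>G\<^esub> x" using z x zl by (simp only: int_ab int_mult_mult)
  also have "\<dots> = [(2 ^ (l + k) :: int)] \<cdot>\<^bsub>G\<^esub> y"
    using x y eq by (simp only: power_add int_mult_mult)
  finally show "z = y" using pow2_cancel z y by blast
qed

lemma dyadic_action_cases:
  assumes "d \<in> carrier dyadic_ring" and x: "x \<in> carrier G"
  obtains a k where "d = of_int a / 2 ^ k" "dyadic_action G d x \<in> carrier G"
    "[(2 ^ k :: int)] \<cdot>\<^bsub>G\<^esub> dyadic_action G d x = [a] \<cdot>\<^bsub>G\<^esub> x"
proof -
  obtain a k where d: "d = of_int a / 2 ^ k" using assms dyadic_carrier_iff by metis
  obtain y where "y \<in> carrier G" "[(2 ^ k :: int)] \<cdot>\<^bsub>G\<^esub> y = [a] \<cdot>\<^bsub>G\<^esub> x"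
    using bij_pow2[of k] int_mult_closed[OF x] unfolding bij_betw_def by (metis imageE)
  with d dyadic_action_eqI[OF x this] that show thesis by blast
qed

text \<open>Each module law is checked by clearing denominators with \<open>dyadic_action_eqI\<close>. The record
  \<open>M\<close> is separate from \<open>G\<close> because the scalar action has to be added to the group as a new field.\<close>
lemma module_of_dyadic_action:
  assumes smult: "\<And>d x. d \<odot>\<^bsub>M\<^esub> x = dyadic_action G d x"
    and same: "carrier M = carrier G" "add M = add G" "zero M = zero G"
  shows "module dyadic_ring M"
proof (intro moduleI cring_dyadic_ring)
  show "abelian_group M"
    using add.r_inv_ex
    by (intro abelian_groupI) (auto simp: same a_ac intro: abelian_groupE(6)[OF abelian_group_axioms])
next
  fix d x assume "d \<in> carrier dyadic_ring" "x \<in> carrier M"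
  then show "d \<odot>\<^bsub>M\<^esub> x \<in> carrier M"
    unfolding smult same using dyadic_action_cases by blast
next
  fix d e x assume "d \<in> carrier dyadic_ring" "e \<in> carrier dyadic_ring" and "x \<in> carrier M"
  then have d: "d \<in> carrier dyadic_ring" and e: "e \<in> carrier dyadic_ring" and x: "x \<in> carrier G"
    by (simp_all add: same)
  obtain a k where dk: "d = of_int a / 2 ^ k" and dx: "dyadic_action G d x \<in> carrier G"
    and da: "[(2 ^ k :: int)] \<cdot>\<^bsub>G\<^esub> dyadic_action G d x = [a] \<cdot>\<^bsub>G\<^esub> x" using dyadic_action_cases[OF d x] .
  obtain b l where el: "e = of_int b / 2 ^ l" and ex: "dyadic_action G e x \<in> carrier G"
    and eb: "[(2 ^ l :: int)] \<cdot>\<^bsub>G\<^esub> dyadic_action G e x = [b] \<cdot>\<^bsub>G\<^esub> x" using dyadic_action_cases[OF e x] .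
  have de: "d + e = of_int (2 ^ l * a + 2 ^ k * b) / 2 ^ (k + l)"
    unfolding dk el by (simp add: add_divide_distrib power_add)
  have "[(2 ^ (k + l) :: int)] \<cdot>\<^bsub>G\<^esub> dyadic_action G d x = [(2 ^ l * a)] \<cdot>\<^bsub>G\<^esub> x"
    using dx x da by (metis int_mult_mult power_add mult.commute)
  moreover have "[(2 ^ (k + l) :: int)] \<cdot>\<^bsub>G\<^esub> dyadic_action G e x = [(2 ^ k * b)] \<cdot>\<^bsub>G\<^esub> x"
    using ex x eb by (metis int_mult_mult power_add)
  ultimately have "dyadic_action G (d + e) x = dyadic_action G d x \<oplus> dyadic_action G e x"
    unfolding de by (intro dyadic_action_eqI) (simp_all add: x dx ex int_mult_distrib int_mult_add)
  then show "(d \<oplus>\<^bsub>dyadic_ring\<^esub> e) \<odot>\<^bsub>M\<^esub> x = d \<odot>\<^bsub>M\<^esub> x \<oplus>\<^bsub>M\<^esub> e \<odot>\<^bsub>M\<^esub> x"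
    by (simp add: smult same)
next
  fix d x y assume d: "d \<in> carrier dyadic_ring" and "x \<in> carrier M" "y \<in> carrier M"
  then have x: "x \<in> carrier G" and y: "y \<in> carrier G" by (simp_all add: same)
  obtain a k where dk: "d = of_int a / 2 ^ k"
    using d dyadic_carrier_iff by metis
  obtain x' where x': "x' \<in> carrier G" "[(2 ^ k :: int)] \<cdot>\<^bsub>G\<^esub> x' = [a] \<cdot>\<^bsub>G\<^esub> x"
    using bij_pow2[of k] int_mult_closed[OF x] unfolding bij_betw_def by (metis imageE)
  obtain y' where y': "y' \<in> carrier G" "[(2 ^ k :: int)] \<cdot>\<^bsub>G\<^esub> y' = [a] \<cdot>\<^bsub>G\<^esub> y"
    using bij_pow2[of k] int_mult_closed[OF y] unfolding bij_betw_def by (metis imageE)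
  have "dyadic_action G d x = x'" "dyadic_action G d y = y'" "dyadic_action G d (x \<oplus> y) = x' \<oplus> y'"
    unfolding dk using x y x' y' by (auto intro!: dyadic_action_eqI simp: int_mult_distrib)
  then show "d \<odot>\<^bsub>M\<^esub> (x \<oplus>\<^bsub>M\<^esub> y) = d \<odot>\<^bsub>M\<^esub> x \<oplus>\<^bsub>M\<^esub> d \<odot>\<^bsub>M\<^esub> y"
    by (simp add: smult same)
next
  fix d e x assume "d \<in> carrier dyadic_ring" "e \<in> carrier dyadic_ring" and "x \<in> carrier M"
  then have d: "d \<in> carrier dyadic_ring" and e: "e \<in> carrier dyadic_ring" and x: "x \<in> carrier G"
    by (simp_all add: same)
  obtain b l where el: "e = of_int b / 2 ^ l" and ex: "dyadic_action G e x \<in> carrier G"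
    and eb: "[(2 ^ l :: int)] \<cdot>\<^bsub>G\<^esub> dyadic_action G e x = [b] \<cdot>\<^bsub>G\<^esub> x" using dyadic_action_cases[OF e x] .
  obtain a k where dk: "d = of_int a / 2 ^ k" and dx: "dyadic_action G d (dyadic_action G e x) \<in> carrier G"
    and da: "[(2 ^ k :: int)] \<cdot>\<^bsub>G\<^esub> dyadic_action G d (dyadic_action G e x) = [a] \<cdot>\<^bsub>G\<^esub> dyadic_action G e x"
    using dyadic_action_cases[OF d ex] .
  have de: "d * e = of_int (a * b) / 2 ^ (l + k)"
    unfolding dk el by (simp add: power_add)
  have "[(2 ^ (l + k) :: int)] \<cdot>\<^bsub>G\<^esub> dyadic_action G d (dyadic_action G e x) = [(2 ^ l * a)] \<cdot>\<^bsub>G\<^esub> dyadic_action G e x"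
    using dx ex da by (metis int_mult_mult power_add)
  also have "\<dots> = [(a * b)] \<cdot>\<^bsub>G\<^esub> x"
    using ex x eb by (metis int_mult_mult mult.commute)
  finally have "dyadic_action G (d * e) x = dyadic_action G d (dyadic_action G e x)"
    unfolding de by (intro dyadic_action_eqI x dx)
  then show "(d \<otimes>\<^bsub>dyadic_ring\<^esub> e) \<odot>\<^bsub>M\<^esub> x = d \<odot>\<^bsub>M\<^esub> (e \<odot>\<^bsub>M\<^esub> x)"
    by (simp add: smult)
next
  fix x assume "x \<in> carrier M"
  then show "\<one>\<^bsub>dyadic_ring\<^esub> \<odot>\<^bsub>M\<^esub> x = x"
    using dyadic_action_eqI[of x x 0 1] by (simp add: smult same)
qed

end

section \<open>Independent generators of dyadic modules\<close>

locale dyadic_module = module dyadic_ring M for M :: "(rat, 'a) module" (structure)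
begin

lemma smult_add: "\<lbrakk>d \<in> carrier dyadic_ring; e \<in> carrier dyadic_ring; x \<in> carrier M\<rbrakk>
    \<Longrightarrow> (d + e) \<odot> x = d \<odot> x \<oplus> e \<odot> x"
  using smult_l_distr by simp

lemma smult_smult: "\<lbrakk>d \<in> carrier dyadic_ring; e \<in> carrier dyadic_ring; x \<in> carrier M\<rbrakk>
    \<Longrightarrow> d \<odot> (e \<odot> x) = (d * e) \<odot> x"
  using smult_assoc1 by simp

lemma one_smult: "x \<in> carrier M \<Longrightarrow> 1 \<odot> x = x"
  using smult_one by simp

lemma zero_smult: "x \<in> carrier M \<Longrightarrow> 0 \<odot> x = \<zero>"
  using smult_l_null by simp

text \<open>Recursion over the list of generators lets one generator be treated at a time, which is the
  shape that all later inductions need.\<close>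
primrec span :: "'a list \<Rightarrow> 'a set" where
  "span [] = {\<zero>}"
| "span (x # xs) = {d \<odot> x \<oplus> v | d v. d \<in> carrier dyadic_ring \<and> v \<in> span xs}"

lemma span_ConsI: "\<lbrakk>d \<in> carrier dyadic_ring; v \<in> span xs\<rbrakk> \<Longrightarrow> d \<odot> x \<oplus> v \<in> span (x # xs)"
  by auto

lemma span_ConsE:
  assumes "v \<in> span (x # xs)"
  obtains d w where "d \<in> carrier dyadic_ring" "w \<in> span xs" "v = d \<odot> x \<oplus> w"
  using assms by auto

lemma span_closed: "\<lbrakk>set xs \<subseteq> carrier M; v \<in> span xs\<rbrakk> \<Longrightarrow> v \<in> carrier M"
  by (induction xs arbitrary: v) auto

lemma zero_in_span: "set xs \<subseteq> carrier M \<Longrightarrow> \<zero> \<in> span xs"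
proof (induction xs)
  case (Cons x xs)
  then have "0 \<odot> x \<oplus> \<zero> \<in> span (x # xs)"
    using dyadic_of_int[of 0] by (intro span_ConsI) auto
  with Cons.prems show ?case by (simp add: zero_smult del: span.simps)
qed simp

lemma smult_add_smult_add:
  "\<lbrakk>d \<in> carrier dyadic_ring; e \<in> carrier dyadic_ring; x \<in> carrier M; v \<in> carrier M; w \<in> carrier M\<rbrakk>
    \<Longrightarrow> (d \<odot> x \<oplus> v) \<oplus> (e \<odot> x \<oplus> w) = (d + e) \<odot> x \<oplus> (v \<oplus> w)"
  by (simp add: smult_add M.a_ac)

lemma smult_smult_add:
  "\<lbrakk>d \<in> carrier dyadic_ring; e \<in> carrier dyadic_ring; x \<in> carrier M; v \<in> carrier M\<rbrakk>
    \<Longrightarrow> d \<odot> (e \<odot> x \<oplus> v) = (d * e) \<odot> x \<oplus> d \<odot> v"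
  by (simp add: smult_smult smult_r_distr)

lemma span_add: "\<lbrakk>set xs \<subseteq> carrier M; v \<in> span xs; w \<in> span xs\<rbrakk> \<Longrightarrow> v \<oplus> w \<in> span xs"
proof (induction xs arbitrary: v w)
  case (Cons x xs)
  obtain d v' where v: "d \<in> carrier dyadic_ring" "v' \<in> span xs" "v = d \<odot> x \<oplus> v'"
    using Cons.prems(2) by (rule span_ConsE)
  obtain e w' where w: "e \<in> carrier dyadic_ring" "w' \<in> span xs" "w = e \<odot> x \<oplus> w'"
    using Cons.prems(3) by (rule span_ConsE)
  have "v \<oplus> w = (d + e) \<odot> x \<oplus> (v' \<oplus> w')"
    unfolding v(3) w(3) using Cons.prems(1) v(1,2) w(1,2) span_closed
    by (intro smult_add_smult_add) auto
  then show ?case using Cons v w by (simp only:) (intro span_ConsI dyadic_add; simp)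
qed simp

lemma span_smult: "\<lbrakk>set xs \<subseteq> carrier M; d \<in> carrier dyadic_ring; v \<in> span xs\<rbrakk> \<Longrightarrow> d \<odot> v \<in> span xs"
proof (induction xs arbitrary: v)
  case (Cons x xs)
  obtain e v' where v: "e \<in> carrier dyadic_ring" "v' \<in> span xs" "v = e \<odot> x \<oplus> v'"
    using Cons.prems(3) by (rule span_ConsE)
  have "d \<odot> v = (d * e) \<odot> x \<oplus> d \<odot> v'"
    unfolding v(3) using Cons.prems(1,2) v(1,2) span_closed by (intro smult_smult_add) auto
  then show ?case using Cons v by (simp only:) (intro span_ConsI dyadic_mult; simp)
qed simp

lemma span_least:
  assumes "set xs \<subseteq> carrier M" "set ys \<subseteq> carrier M" "set xs \<subseteq> span ys"
  shows "span xs \<subseteq> span ys"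
  using assms(1,3)
proof (induction xs)
  case Nil
  then show ?case using zero_in_span[OF assms(2)] by simp
next
  case (Cons x xs)
  then show ?case by (auto intro!: span_add span_smult assms(2))
qed

lemma span_Cons_superset:
  assumes "set (x # xs) \<subseteq> carrier M"
  shows "span xs \<subseteq> span (x # xs)"
proof
  fix v assume v: "v \<in> span xs"
  then have "0 \<odot> x \<oplus> v \<in> span (x # xs)"
    using dyadic_of_int[of 0] by (intro span_ConsI) auto
  then show "v \<in> span (x # xs)" using assms v span_closed[of xs v] by (simp add: zero_smult del: span.simps)
qed

lemma in_span: "set xs \<subseteq> carrier M \<Longrightarrow> x \<in> set xs \<Longrightarrow> x \<in> span xs"
proof (induction xs)
  case (Cons y ys)
  show ?case
  proof (cases "x = y")
    case True
    have "1 \<odot> y \<oplus> \<zero> \<in> span (y # ys)"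
      using dyadic_of_int[of 1] Cons.prems zero_in_span[of ys] by (intro span_ConsI) auto
    with Cons.prems(1) True show ?thesis by (simp add: one_smult del: span.simps)
  next
    case False
    with Cons show ?thesis using span_Cons_superset[of y ys] by auto
  qed
qed simp

lemma lincomb2_in_span:
  assumes "set (x # y # t) \<subseteq> carrier M" "a \<in> carrier dyadic_ring" "b \<in> carrier dyadic_ring"
  shows "a \<odot> x \<oplus> b \<odot> y \<in> span (x # y # t)"
  using assms by (intro span_add span_smult in_span) auto

lemma lincomb2_of_lincomb2:
  assumes "a \<in> carrier dyadic_ring" "b \<in> carrier dyadic_ring" "c \<in> carrier dyadic_ring"
    "d \<in> carrier dyadic_ring" "p \<in> carrier dyadic_ring" "q \<in> carrier dyadic_ring"
    "x \<in> carrier M" "y \<in> carrier M"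
  shows "p \<odot> (a \<odot> x \<oplus> b \<odot> y) \<oplus> q \<odot> (c \<odot> x \<oplus> d \<odot> y)
    = (p * a + q * c) \<odot> x \<oplus> (p * b + q * d) \<odot> y"
  using assms by (simp add: smult_r_distr smult_smult smult_add dyadic_mult M.a_ac)

text \<open>With \<open>p = g c\<^sub>1\<close>, \<open>q = g c\<^sub>2\<close> and \<open>a c\<^sub>1 + b c\<^sub>2 = 1\<close>, the matrix with rows \<open>(c\<^sub>1, c\<^sub>2)\<close> and
  \<open>(-b, a)\<close> has determinant 1. It sends \<open>(x, y)\<close> to new generators \<open>(u, v)\<close> of the same span, and
  \<open>p x + q y = g u\<close>.\<close>
lemma bezout_span:
  fixes p q :: int
  assumes M: "set (x # y # t) \<subseteq> carrier M"
  obtains u v where "u \<in> carrier M" "v \<in> carrier M" "span (u # v # t) = span (x # y # t)"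
    "of_int p \<odot> x \<oplus> of_int q \<odot> y = of_int (gcd p q) \<odot> u"
proof (cases "gcd p q = 0")
  case True
  with M that[of x y] show ?thesis by (simp add: zero_smult)
next
  case False
  \<comment> \<open>The cofactors \<open>c1\<close>, \<open>c2\<close> are coprime because \<open>g\<close> is not zero.\<close>
  define g where "g = gcd p q"
  obtain c1 c2 where c: "p = g * c1" "q = g * c2"
    unfolding g_def by (metis dvd_def gcd_dvd1 gcd_dvd2)
  obtain a b where "a * p + b * q = g"
    unfolding g_def using bezout_int by metis
  then have "g * (a * c1 + b * c2) = g * 1" unfolding c by (simp add: algebra_simps)
  then have det: "a * c1 + b * c2 = 1" using False unfolding g_def[symmetric] mult_cancel_left by simp
  have x: "x \<in> carrier M" and y: "y \<in> carrier M" and t: "set t \<subseteq> carrier M" using M by auto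
  note D = dyadic_of_int dyadic_uminus
  define u where "u = of_int c1 \<odot> x \<oplus> of_int c2 \<odot> y"
  define v where "v = of_int (-b) \<odot> x \<oplus> of_int a \<odot> y"
  have u: "u \<in> carrier M" and v: "v \<in> carrier M"
    unfolding u_def v_def using x y D by (auto simp del: of_int_minus)
  have detr: "of_int a * of_int c1 + of_int b * of_int c2 = (1::rat)"
    using det by (metis of_int_1 of_int_add of_int_mult)
  have xu: "x = of_int a \<odot> u \<oplus> of_int (- c2) \<odot> v"
  proof -
    have "of_int a \<odot> u \<oplus> of_int (- c2) \<odot> v
        = (of_int a * of_int c1 + of_int (- c2) * of_int (- b)) \<odot> x
          \<oplus> (of_int a * of_int c2 + of_int (- c2) * of_int a) \<odot> y"
      unfolding u_def v_def by (intro lincomb2_of_lincomb2 D x y)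
    also have "\<dots> = 1 \<odot> x \<oplus> 0 \<odot> y"
      using detr by (simp add: mult.commute)
    finally show ?thesis using x y by (simp add: one_smult zero_smult)
  qed
  have yv: "y = of_int b \<odot> u \<oplus> of_int c1 \<odot> v"
  proof -
    have "of_int b \<odot> u \<oplus> of_int c1 \<odot> v
        = (of_int b * of_int c1 + of_int c1 * of_int (- b)) \<odot> x
          \<oplus> (of_int b * of_int c2 + of_int c1 * of_int a) \<odot> y"
      unfolding u_def v_def by (intro lincomb2_of_lincomb2 D x y)
    also have "\<dots> = 0 \<odot> x \<oplus> 1 \<odot> y"
      using detr by (simp add: mult.commute add.commute)
    finally show ?thesis using x y by (simp add: one_smult zero_smult)
  qed
  have uvt: "set (u # v # t) \<subseteq> carrier M" using u v t by simp
  have "span (u # v # t) \<subseteq> span (x # y # t)"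
  proof (rule span_least[OF uvt M])
    have "u \<in> span (x # y # t)" "v \<in> span (x # y # t)"
      unfolding u_def v_def by (intro lincomb2_in_span M D)+
    then show "set (u # v # t) \<subseteq> span (x # y # t)" using in_span[OF M] by auto
  qed
  moreover have "span (x # y # t) \<subseteq> span (u # v # t)"
  proof (rule span_least[OF M uvt])
    have "x \<in> span (u # v # t)" "y \<in> span (u # v # t)"
      by (subst xu, intro lincomb2_in_span uvt D, subst yv, intro lincomb2_in_span uvt D)
    then show "set (x # y # t) \<subseteq> span (u # v # t)" using in_span[OF uvt] by auto
  qed
  moreover have "of_int p \<odot> x \<oplus> of_int q \<odot> y = of_int g \<odot> u"
    unfolding u_def c using x y D by (simp add: smult_r_distr smult_smult)
  ultimately show thesis using that[OF u v] unfolding g_def by blast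
qed

lemma span_Cons_mono:
  assumes "span xs = span ys" shows "span (x # xs) = span (x # ys)"
  using assms by simp

lemma span_rescale_hd:
  assumes "d \<in> carrier dyadic_ring" "e \<in> carrier dyadic_ring" "d * e = 1" "set (x # t) \<subseteq> carrier M"
  shows "span (d \<odot> x # t) = span (x # t)"
proof
  have dx: "set (d \<odot> x # t) \<subseteq> carrier M" using assms by auto
  have x: "x \<in> carrier M" using assms by simp
  show "span (d \<odot> x # t) \<subseteq> span (x # t)"
    using in_span[OF assms(4)] span_smult[OF assms(4,1)] assms(1)
    by (intro span_least dx assms(4)) (auto simp del: span.simps)
  have "x = e \<odot> (d \<odot> x)"
    using assms x by (simp add: smult_smult mult.commute one_smult)
  also have "\<dots> \<in> span (d \<odot> x # t)"
    using in_span[OF dx] by (rule span_smult[OF dx assms(2)]) (simp del: span.simps)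
  finally have "x \<in> span (d \<odot> x # t)" .
  then show "span (x # t) \<subseteq> span (d \<odot> x # t)"
    using in_span[OF dx] by (intro span_least assms(4) dx) (auto simp del: span.simps)
qed

lemma dyadic_pow2: "2 ^ k \<in> carrier dyadic_ring" "1 / 2 ^ k \<in> carrier dyadic_ring"
  using dyadic_of_int[of "2 ^ k"] by (simp_all, unfold dyadic_carrier_iff, metis of_int_1)

text \<open>This is Rado's lemma in the form used below: any element of a span is an integer multiple of
  the first member of a suitable generating family of the same length. The coefficients are merged
  into their gcd one after another; before that, the denominator of a coefficient \<open>p / 2\<^sup>k\<close> is moved
  into its generator, which does not change the span.\<close>
lemma span_elem_multiple_of_generator:
  assumes "set xs \<subseteq> carrier M" "xs \<noteq> []" "v \<in> span xs"
  obtains g :: int and u t where "set (u # t) \<subseteq> carrier M" "length (u # t) = length xs"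
    "span (u # t) = span xs" "v = of_int g \<odot> u"
  using assms
proof (induction xs arbitrary: v thesis)
  case (Cons x xs)
  have x: "x \<in> carrier M" and xs: "set xs \<subseteq> carrier M" using Cons.prems(2) by auto
  obtain d w where d: "d \<in> carrier dyadic_ring" and w: "w \<in> span xs" and v: "v = d \<odot> x \<oplus> w"
    using Cons.prems(4) by (rule span_ConsE)
  obtain p k where dk: "d = of_int p / 2 ^ k" using d dyadic_carrier_iff by metis
  define x' where "x' = (1 / 2 ^ k) \<odot> x"
  have x': "x' \<in> carrier M" unfolding x'_def using x dyadic_pow2 by auto
  have dx: "d \<odot> x = of_int p \<odot> x'"
    unfolding x'_def dk using x dyadic_pow2 dyadic_of_int by (simp add: smult_smult)
  have sp: "span (x' # xs) = span (x # xs)"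
    unfolding x'_def using dyadic_pow2 Cons.prems(2)
    by (intro span_rescale_hd[where e = "2 ^ k"]) auto
  show ?case
  proof (cases "xs = []")
    case True
    then have "v = of_int p \<odot> x'" using v w dx x' dyadic_of_int by simp
    then show ?thesis using Cons.prems(1)[of x' xs p] sp x' xs by simp
  next
    case False
    obtain g :: int and y t where y: "set (y # t) \<subseteq> carrier M" "length (y # t) = length xs"
      "span (y # t) = span xs" "w = of_int g \<odot> y"
      by (rule Cons.IH[OF _ xs False w])
    have "set (x' # y # t) \<subseteq> carrier M" using x' y by simp
    then obtain a b where ab: "a \<in> carrier M" "b \<in> carrier M" "span (a # b # t) = span (x' # y # t)"
      "of_int p \<odot> x' \<oplus> of_int g \<odot> y = of_int (gcd p g) \<odot> a" by (rule bezout_span)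
    have "span (a # b # t) = span (x # xs)"
      using ab(3) span_Cons_mono[OF y(3), of x'] sp by (simp only:)
    moreover have "v = of_int (gcd p g) \<odot> a" using v dx y(4) ab(4) by simp
    moreover have "set (a # b # t) \<subseteq> carrier M" "length (a # b # t) = length (x # xs)"
      using ab y by auto
    ultimately show ?thesis using Cons.prems(1) by blast
  qed
qed simp

text \<open>A nontrivial relation \<open>p z = w\<close> with \<open>w\<close> in the span of the other generators turns into
  \<open>p z - g y = 0\<close> by Rado's lemma, and then into \<open>gcd p g u = 0\<close> by a Bezout step.
  The descent on torsion orders relies on the annihilator of the new generator dividing \<open>p\<close>.\<close>
lemma relation_gives_torsion_generator:
  fixes p :: int
  assumes M: "set (z # zs) \<subseteq> carrier M" and rel: "of_int p \<odot> z \<in> span zs"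
    and nz: "of_int p \<odot> z \<noteq> \<zero>"
  obtains g :: int and u t where "0 < g" "g dvd p" "of_int g \<odot> u = \<zero>"
    "set (u # t) \<subseteq> carrier M" "length (u # t) = length (z # zs)" "span (u # t) = span (z # zs)"
proof -
  have z: "z \<in> carrier M" and zs: "set zs \<subseteq> carrier M" using M by auto
  have p0: "p \<noteq> 0" using nz z zero_smult by auto
  have "zs \<noteq> []" using rel nz by auto
  obtain g :: int and y t where y: "set (y # t) \<subseteq> carrier M" "length (y # t) = length zs"
      "span (y # t) = span zs" "of_int p \<odot> z = of_int g \<odot> y"
    by (rule span_elem_multiple_of_generator[OF zs \<open>zs \<noteq> []\<close> rel])
  have "set (z # y # t) \<subseteq> carrier M" using z y by simp
  then obtain a b where ab: "a \<in> carrier M" "b \<in> carrier M" "span (a # b # t) = span (z # y # t)"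
      "of_int p \<odot> z \<oplus> of_int (- g) \<odot> y = of_int (gcd p (- g)) \<odot> a" by (rule bezout_span)
  have "of_int p \<odot> z \<oplus> of_int (- g) \<odot> y = of_int (g + - g) \<odot> y"
    unfolding y(4) of_int_add using y(1) dyadic_of_int dyadic_uminus by (subst smult_add) auto
  also have "\<dots> = \<zero>" using y(1) by (simp add: zero_smult)
  finally have "of_int (gcd p (- g)) \<odot> a = \<zero>" using ab(4) by simp
  moreover have "span (a # b # t) = span (z # zs)"
    using ab(3) span_Cons_mono[OF y(3), of z] by (simp only:)
  ultimately show thesis
    using that[of "gcd p (- g)" a "b # t"] p0 ab y by simp
qed

text \<open>Powers of 2 are units, so denominators affect neither membership in a span nor vanishing. This
  reduces questions about dyadic multiples to integer multiples.\<close>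
lemma smult_in_span_denominator:
  assumes "set xs \<subseteq> carrier M" "z \<in> carrier M" 
  shows "(of_int p / 2 ^ k) \<odot> z \<in> span xs \<longleftrightarrow> of_int p \<odot> z \<in> span xs"
    and "(of_int p / 2 ^ k) \<odot> z = \<zero> \<longleftrightarrow> of_int p \<odot> z = \<zero>"
proof -
  have 1: "2 ^ k \<odot> ((of_int p / 2 ^ k) \<odot> z) = of_int p \<odot> z"
    using assms dyadic_pow2[of k] dyadic_carrier_iff by (subst smult_smult) auto
  have 2: "(1 / 2 ^ k) \<odot> (of_int p \<odot> z) = (of_int p / 2 ^ k) \<odot> z"
    using assms dyadic_pow2[of k] dyadic_of_int[of p] by (subst smult_smult) auto
  show "(of_int p / 2 ^ k) \<odot> z \<in> span xs \<longleftrightarrow> of_int p \<odot> z \<in> span xs"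
    using 1 2 span_smult[OF assms(1)] dyadic_pow2[of k] by metis
  show "(of_int p / 2 ^ k) \<odot> z = \<zero> \<longleftrightarrow> of_int p \<odot> z = \<zero>"
    using 1 2 smult_r_null dyadic_pow2[of k] by metis
qed

text \<open>Among all generating families of the given length, choose one whose first member \<open>z\<close> is
  annihilated by the smallest possible positive integer \<open>n\<close>. A nontrivial relation for \<open>z\<close> may be
  reduced modulo \<open>n\<close>, and would then produce a family whose first member is annihilated by a positive
  integer smaller than \<open>n\<close>. If no family starts with a torsion element, any nontrivial relation
  is contradictory for the same reason, and every family will do.\<close>
lemma split_off_generator:
  assumes M: "set xs \<subseteq> carrier M" and "xs \<noteq> []"
  obtains z zs where "set (z # zs) \<subseteq> carrier M" "length (z # zs) = length xs"
    "span (z # zs) = span xs"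
    "\<And>d. \<lbrakk>d \<in> carrier dyadic_ring; d \<odot> z \<in> span zs\<rbrakk> \<Longrightarrow> d \<odot> z = \<zero>"
proof -
  note found = that
  define gens where "gens z zs \<longleftrightarrow> set (z # zs) \<subseteq> carrier M \<and> length (z # zs) = length xs
    \<and> span (z # zs) = span xs" for z zs
  \<comment> \<open>The first member of some generating family of the right length is annihilated by \<open>n\<close>.\<close>
  define tors where "tors n \<longleftrightarrow> 0 < n \<and> (\<exists>z zs. gens z zs \<and> of_int (int n) \<odot> z = \<zero>)" for n :: nat
  have step: "\<exists>g. 0 < g \<and> g dvd p \<and> tors (nat g)"
    if gz: "gens z zs" and "of_int p \<odot> z \<in> span zs" "of_int p \<odot> z \<noteq> \<zero>" for p :: int and z zs
  proof -
    have "set (z # zs) \<subseteq> carrier M" using gz unfolding gens_def by simp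
    from relation_gives_torsion_generator[OF this that(2,3)] obtain g u t where
      g: "0 < g" "g dvd p" and u: "of_int g \<odot> u = \<zero>" and ut: "set (u # t) \<subseteq> carrier M"
        "length (u # t) = length (z # zs)" "span (u # t) = span (z # zs)" by blast
    have "gens u t" using ut gz unfolding gens_def by simp
    moreover have "of_int (int (nat g)) \<odot> u = \<zero>" using u g(1) by simp
    ultimately show ?thesis unfolding tors_def using g by (metis zero_less_nat_eq)
  qed
  have reduce: thesis if gz: "gens z zs"
    and int: "\<And>p::int. of_int p \<odot> z \<in> span zs \<Longrightarrow> of_int p \<odot> z = \<zero>" for z zs
  proof (rule found)
    show zs: "set (z # zs) \<subseteq> carrier M" "length (z # zs) = length xs" "span (z # zs) = span xs"
      using gz unfolding gens_def by auto
    fix d assume "d \<in> carrier dyadic_ring" and dz: "d \<odot> z \<in> span zs"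
    then obtain p k where "d = of_int p / 2 ^ k" using dyadic_carrier_iff by metis
    then show "d \<odot> z = \<zero>" using int[of p] dz zs(1) smult_in_span_denominator[of zs z p k] by simp
  qed
  show thesis
  proof (cases "\<exists>n. tors n")
    case True
    define n where "n = (LEAST n. tors n)"
    have "tors n" using True unfolding n_def by (metis LeastI_ex)
    then obtain z zs where n0: "0 < n" and gz: "gens z zs" and nz: "of_int (int n) \<odot> z = \<zero>"
      unfolding tors_def by blast
    show thesis
    proof (rule reduce[OF gz])
      fix p :: int assume pz: "of_int p \<odot> z \<in> span zs"
      have z: "z \<in> carrier M" using gz unfolding gens_def by simp
      have "of_int (p div int n) \<odot> (of_int (int n) \<odot> z) \<oplus> of_int (p mod int n) \<odot> z
          = (of_int (p div int n) * of_int (int n)) \<odot> z \<oplus> of_int (p mod int n) \<odot> z"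
        by (simp only: smult_smult dyadic_of_int z)
      also have "\<dots> = (of_int (p div int n) * of_int (int n) + of_int (p mod int n)) \<odot> z"
        by (rule smult_add[symmetric]) (intro dyadic_mult dyadic_of_int z)+
      also have "\<dots> = of_int p \<odot> z"
        by (simp only: of_int_mult[symmetric] of_int_add[symmetric] div_mult_mod_eq)
      finally have mod: "of_int p \<odot> z = of_int (p mod int n) \<odot> z"
        using nz z dyadic_of_int by (simp del: of_int_of_nat_eq)
      show "of_int p \<odot> z = \<zero>"
      proof (rule ccontr)
        assume nonzero: "of_int p \<odot> z \<noteq> \<zero>"
        then obtain g where g: "0 < g" "g dvd p mod int n" "tors (nat g)"
          using step[OF gz, of "p mod int n"] pz mod by metis
        have "p mod int n \<noteq> 0" using nonzero mod zero_smult[OF z] by (metis of_int_0)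
        moreover have "0 \<le> p mod int n" using n0 by simp
        ultimately have "0 < p mod int n" by linarith
        then have "g \<le> p mod int n" using g(2) by (rule zdvd_imp_le[rotated])
        also have "\<dots> < int n" using n0 by simp
        finally have "nat g < n" using g(1) by linarith
        then show False using g(3) not_less_Least unfolding n_def by blast
      qed
    qed
  next
    case False
    obtain z zs where "xs = z # zs" using assms(2) by (cases xs) auto
    then have gz: "gens z zs" using M unfolding gens_def by simp
    show thesis by (rule reduce[OF gz]) (use step[OF gz] False in blast)
  qed
qed

text \<open>Independence in the sense of a direct sum of cyclic modules: the multiples of a generator
  meet the span of the later ones only in zero, but the generator itself may be torsion.\<close>
primrec independent :: "'a list \<Rightarrow> bool" where
  "independent [] \<longleftrightarrow> True"
| "independent (x # xs) \<longleftrightarrow> independent xs \<and>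
     (\<forall>d\<in>carrier dyadic_ring. d \<odot> x \<in> span xs \<longrightarrow> d \<odot> x = \<zero>)"

theorem exists_independent_generators:
  assumes "set xs \<subseteq> carrier M"
  shows "\<exists>ys. set ys \<subseteq> carrier M \<and> independent ys \<and> span ys = span xs"
  using assms
proof (induction "length xs" arbitrary: xs)
  case 0
  then show ?case by (intro exI[of _ "[]"]) auto
next
  case (Suc n)
  then have "xs \<noteq> []" by auto
  then obtain z zs where z: "set (z # zs) \<subseteq> carrier M" "length (z # zs) = length xs"
    "span (z # zs) = span xs"
    and direct: "\<And>d. \<lbrakk>d \<in> carrier dyadic_ring; d \<odot> z \<in> span zs\<rbrakk> \<Longrightarrow> d \<odot> z = \<zero>"
    using split_off_generator[OF Suc.prems] by blast
  obtain ys where ys: "set ys \<subseteq> carrier M" "independent ys" "span ys = span zs"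
    using Suc.hyps(1)[of zs] Suc.hyps(2) z(1,2) by auto
  have "span (z # ys) = span xs" using span_Cons_mono[OF ys(3), of z] z(3) by (simp only:)
  then show ?case using ys z(1) direct by (intro exI[of _ "z # ys"]) (simp del: span.simps)
qed

end

section \<open>Isomorphisms and direct sums of magmas\<close>

lemma rack_isomorphicI:
  assumes "bij_betw h (carrier X) (carrier Y)"
    and "\<And>x y. \<lbrakk>x \<in> carrier X; y \<in> carrier X\<rbrakk> \<Longrightarrow> h (x \<star>\<^bsub>X\<^esub> y) = h x \<star>\<^bsub>Y\<^esub> h y"
  shows "rack_isomorphic X Y"
proof -
  have "h \<in> magma_iso X Y"
    using assms by (auto simp: magma_iso_def magma_hom_def bij_betw_def)
  then show ?thesis unfolding rack_isomorphic_def by blast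
qed

lemma rack_isomorphicE:
  assumes "rack_isomorphic X Y"
  obtains h where "bij_betw h (carrier X) (carrier Y)"
    and "\<And>x y. \<lbrakk>x \<in> carrier X; y \<in> carrier X\<rbrakk> \<Longrightarrow> h (x \<star>\<^bsub>X\<^esub> y) = h x \<star>\<^bsub>Y\<^esub> h y"
  using assms unfolding rack_isomorphic_def magma_iso_def magma_hom_def by blast

lemma rack_isomorphic_trans [trans]:
  assumes "rack_isomorphic X Y" "rack_isomorphic Y Z"
  shows "rack_isomorphic X Z"
proof -
  obtain g where g: "bij_betw g (carrier X) (carrier Y)"
    "\<And>x y. \<lbrakk>x \<in> carrier X; y \<in> carrier X\<rbrakk> \<Longrightarrow> g (x \<star>\<^bsub>X\<^esub> y) = g x \<star>\<^bsub>Y\<^esub> g y"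
    using assms(1) by (rule rack_isomorphicE) blast
  obtain h where h: "bij_betw h (carrier Y) (carrier Z)"
    "\<And>x y. \<lbrakk>x \<in> carrier Y; y \<in> carrier Y\<rbrakk> \<Longrightarrow> h (x \<star>\<^bsub>Y\<^esub> y) = h x \<star>\<^bsub>Z\<^esub> h y"
    using assms(2) by (rule rack_isomorphicE) blast
  show ?thesis
    by (rule rack_isomorphicI[OF bij_betw_trans[OF g(1) h(1)]]) (simp add: g(2) h(2) bij_betwE[OF g(1)])
qed

lemma rack_isomorphic_sym:
  assumes "rack_isomorphic X Y" "magma X"
  shows "rack_isomorphic Y X"
proof -
  obtain h where h: "bij_betw h (carrier X) (carrier Y)"
    and hom: "\<And>x y. \<lbrakk>x \<in> carrier X; y \<in> carrier X\<rbrakk> \<Longrightarrow> h (x \<star>\<^bsub>X\<^esub> y) = h x \<star>\<^bsub>Y\<^esub> h y"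
    using assms(1) by (rule rack_isomorphicE) blast
  let ?g = "inv_into (carrier X) h"
  show ?thesis
  proof (rule rack_isomorphicI[OF bij_betw_inv_into[OF h]])
    fix x y assume "x \<in> carrier Y" "y \<in> carrier Y"
    then obtain a b where a: "a \<in> carrier X" "x = h a" and b: "b \<in> carrier X" "y = h b"
      using h by (metis bij_betw_def imageE)
    have "?g (x \<star>\<^bsub>Y\<^esub> y) = ?g (h (a \<star>\<^bsub>X\<^esub> b))" using a b hom by simp
    also have "\<dots> = a \<star>\<^bsub>X\<^esub> b"
      using a b magma.mop_closed[OF assms(2)] by (simp add: bij_betw_inv_into_left[OF h])
    finally show "?g (x \<star>\<^bsub>Y\<^esub> y) = ?g x \<star>\<^bsub>X\<^esub> ?g y"
      using a b by (simp add: bij_betw_inv_into_left[OF h])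
  qed
qed

lemma rack_isomorphic_refl: "rack_isomorphic X X"
  by (rule rack_isomorphicI[of id]) auto

lemma direct_sum2_simps [simp]:
  "carrier (direct_sum2 X Y) = carrier X \<times> carrier Y"
  "p \<star>\<^bsub>direct_sum2 X Y\<^esub> q = (fst p \<star>\<^bsub>X\<^esub> fst q, snd p \<star>\<^bsub>Y\<^esub> snd q)"
  by (simp_all add: direct_sum2_def)

lemma direct_sum_simps [simp]:
  "carrier (direct_sum I X) = (\<Pi>\<^sub>E i\<in>I. carrier (X i))"
  "x \<star>\<^bsub>direct_sum I X\<^esub> y = (\<lambda>i\<in>I. x i \<star>\<^bsub>X i\<^esub> y i)"
  by (simp_all add: direct_sum_def)

lemma direct_sum2_cong:
  assumes "rack_isomorphic X X'" "rack_isomorphic Y Y'"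
  shows "rack_isomorphic (direct_sum2 X Y) (direct_sum2 X' Y')"
proof -
  obtain g where g: "bij_betw g (carrier X) (carrier X')"
    "\<And>x y. \<lbrakk>x \<in> carrier X; y \<in> carrier X\<rbrakk> \<Longrightarrow> g (x \<star>\<^bsub>X\<^esub> y) = g x \<star>\<^bsub>X'\<^esub> g y"
    using assms(1) by (rule rack_isomorphicE) blast
  obtain h where h: "bij_betw h (carrier Y) (carrier Y')"
    "\<And>x y. \<lbrakk>x \<in> carrier Y; y \<in> carrier Y\<rbrakk> \<Longrightarrow> h (x \<star>\<^bsub>Y\<^esub> y) = h x \<star>\<^bsub>Y'\<^esub> h y"
    using assms(2) by (rule rack_isomorphicE) blast
  show ?thesis
  proof (rule rack_isomorphicI)
    show "bij_betw (map_prod g h) (carrier (direct_sum2 X Y)) (carrier (direct_sum2 X' Y'))"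
      using bij_betw_map_prod[OF g(1) h(1)] by simp
  qed (auto simp: g(2) h(2))
qed

lemma direct_sum2_assoc:
  "rack_isomorphic (direct_sum2 X (direct_sum2 Y Z)) (direct_sum2 (direct_sum2 X Y) Z)"
  by (rule rack_isomorphicI[of "\<lambda>p. ((fst p, fst (snd p)), snd (snd p))"])
     (auto intro!: bij_betw_byWitness[of _ "\<lambda>p. (fst (fst p), (snd (fst p), snd p))"])

lemma direct_sum2_left_commute:
  "rack_isomorphic (direct_sum2 X (direct_sum2 Y Z)) (direct_sum2 Y (direct_sum2 X Z))"
  by (rule rack_isomorphicI[of "\<lambda>p. (fst (snd p), (fst p, snd (snd p)))"])
     (auto intro!: bij_betw_byWitness[of _ "\<lambda>p. (fst (snd p), (fst p, snd (snd p)))"])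

text \<open>This translates between binary sums, which match the recursion over a list of generators, and
  sums indexed by an initial segment of the natural numbers.\<close>
lemma direct_sum_insert:
  assumes "j \<notin> I"
  shows "rack_isomorphic (direct_sum2 (X j) (direct_sum I X)) (direct_sum (insert j I) X)"
proof (rule rack_isomorphicI)
  let ?f = "\<lambda>p. \<lambda>i\<in>insert j I. if i = j then fst p else snd p i"
  show "bij_betw ?f (carrier (direct_sum2 (X j) (direct_sum I X))) (carrier (direct_sum (insert j I) X))"
  proof (rule bij_betw_byWitness[of _ "\<lambda>u. (u j, restrict u I)"])
    show "\<forall>p\<in>carrier (direct_sum2 (X j) (direct_sum I X)). (?f p j, restrict (?f p) I) = p"
      using assms by (auto simp: fun_eq_iff PiE_def extensional_def)
    show "\<forall>u\<in>carrier (direct_sum (insert j I) X). ?f (u j, restrict u I) = u"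
      by (auto simp: fun_eq_iff PiE_def extensional_def)
  qed (auto split: if_splits)
  show "?f (p \<star>\<^bsub>direct_sum2 (X j) (direct_sum I X)\<^esub> q) = ?f p \<star>\<^bsub>direct_sum (insert j I) X\<^esub> ?f q"
    if "p \<in> carrier (direct_sum2 (X j) (direct_sum I X))"
      "q \<in> carrier (direct_sum2 (X j) (direct_sum I X))" for p q
    using assms by (auto simp: fun_eq_iff)
qed

lemma direct_sum_cong:
  assumes "\<And>i. i \<in> I \<Longrightarrow> X i = Y i"
  shows "direct_sum I X = direct_sum I Y"
  unfolding direct_sum_def using assms
  by (auto intro!: PiE_cong restrict_ext simp: fun_eq_iff)

lemma rack_isomorphic_unit_direct_sum2:
  assumes "carrier X = {u}"
  shows "rack_isomorphic (direct_sum2 X Y) Y"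
  by (rule rack_isomorphicI[of snd]) (auto simp: assms intro!: bij_betw_byWitness[of _ "Pair u"])

lemma magma_direct_sum2: "\<lbrakk>magma X; magma Y\<rbrakk> \<Longrightarrow> magma (direct_sum2 X Y)"
  by (auto simp: magma_def)

lemma medial_direct_sum2: "\<lbrakk>medial X; medial Y\<rbrakk> \<Longrightarrow> medial (direct_sum2 X Y)"
  by (auto simp: medial_def)

lemma commutative_direct_sum2: "\<lbrakk>commutative X; commutative Y\<rbrakk> \<Longrightarrow> commutative (direct_sum2 X Y)"
  by (auto simp: commutative_def)

lemma medial_direct_sum: "(\<And>i. i \<in> I \<Longrightarrow> medial (X i)) \<Longrightarrow> medial (direct_sum I X)"
  by (auto simp: medial_def fun_eq_iff PiE_iff)

lemma commutative_direct_sum: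
  "(\<And>i. i \<in> I \<Longrightarrow> commutative (X i)) \<Longrightarrow> commutative (direct_sum I X)"
  by (auto simp: commutative_def fun_eq_iff PiE_iff)

lemma medial_commutative_transfer:
  assumes "rack_isomorphic X Y" "magma X"
  shows "medial Y \<Longrightarrow> medial X" and "commutative Y \<Longrightarrow> commutative X"
proof -
  obtain h where h: "bij_betw h (carrier X) (carrier Y)"
    and hom: "\<And>x y. \<lbrakk>x \<in> carrier X; y \<in> carrier X\<rbrakk> \<Longrightarrow> h (x \<star>\<^bsub>X\<^esub> y) = h x \<star>\<^bsub>Y\<^esub> h y"
    using assms(1) by (rule rack_isomorphicE) blast
  note closed = magma.mop_closed[OF assms(2)] and inj = inj_onD[OF bij_betw_imp_inj_on[OF h]]
  note in_Y = bij_betwE[OF h, rule_format]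
  show "medial X" if "medial Y"
    unfolding medial_def
  proof (intro ballI inj)
    fix a b c d assume "a \<in> carrier X" "b \<in> carrier X" "c \<in> carrier X" "d \<in> carrier X"
    then show "h ((a \<star>\<^bsub>X\<^esub> b) \<star>\<^bsub>X\<^esub> (c \<star>\<^bsub>X\<^esub> d)) = h ((a \<star>\<^bsub>X\<^esub> c) \<star>\<^bsub>X\<^esub> (b \<star>\<^bsub>X\<^esub> d))"
      using that in_Y unfolding medial_def by (simp add: hom closed)
  qed (auto intro: closed)
  show "commutative X" if "commutative Y"
    unfolding commutative_def
  proof (intro ballI inj)
    fix a b assume "a \<in> carrier X" "b \<in> carrier X"
    then show "h (a \<star>\<^bsub>X\<^esub> b) = h (b \<star>\<^bsub>X\<^esub> a)"
      using that in_Y unfolding commutative_def by (simp add: hom)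
  qed (auto intro: closed)
qed

section \<open>The module of a pointed medial commutative rack\<close>

locale medial_commutative_rack = rack X for X (structure) +
  assumes medial: "medial X" and commutative: "commutative X"
begin

lemma comm: "\<lbrakk>x \<in> carrier X; y \<in> carrier X\<rbrakk> \<Longrightarrow> x \<star> y = y \<star> x"
  using commutative unfolding commutative_def by blast

lemma medial_law:
  "\<lbrakk>a \<in> carrier X; b \<in> carrier X; c \<in> carrier X; d \<in> carrier X\<rbrakk>
    \<Longrightarrow> (a \<star> b) \<star> (c \<star> d) = (a \<star> c) \<star> (b \<star> d)"
  using medial unfolding medial_def by blast

lemma right_bij: "x \<in> carrier X \<Longrightarrow> bij_betw (right_translation X x) (carrier X) (carrier X)"
  using right_translation_auto unfolding magma_iso_def by blast

lemma right_cancel: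
  "\<lbrakk>x \<star> z = y \<star> z; x \<in> carrier X; y \<in> carrier X; z \<in> carrier X\<rbrakk> \<Longrightarrow> x = y"
  using right_bij[of z] unfolding bij_betw_def inj_on_def right_translation_def by blast

lemma right_distrib:
  "\<lbrakk>x \<in> carrier X; y \<in> carrier X; z \<in> carrier X\<rbrakk> \<Longrightarrow> (y \<star> z) \<star> x = (y \<star> x) \<star> (z \<star> x)"
  using right_translation_auto[of x] unfolding magma_iso_def magma_hom_def right_translation_def by blast

text \<open>Right distributivity gives \<open>(x * x) * x = (x * x) * (x * x)\<close>; by commutativity the left side is
  \<open>x * (x * x)\<close>, and \<open>x * x\<close> can be cancelled on the right.\<close>
lemma idem:
  assumes x: "x \<in> carrier X"
  shows "x \<star> x = x"
proof (rule right_cancel[symmetric])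
  show "x \<star> (x \<star> x) = (x \<star> x) \<star> (x \<star> x)"
    using comm[of x "x \<star> x"] right_distrib[of x x x] x mop_closed by simp
qed (use x mop_closed in auto)

abbreviation rdiv :: "'a \<Rightarrow> 'a \<Rightarrow> 'a" where
  "rdiv y x \<equiv> inv_into (carrier X) (right_translation X y) x"

lemma rdiv:
  assumes "x \<in> carrier X" "y \<in> carrier X"
  shows "rdiv y x \<in> carrier X" "rdiv y x \<star> y = x"
proof -
  have "x \<in> right_translation X y ` carrier X"
    using right_bij[OF assms(2)] assms(1) unfolding bij_betw_def by blast
  then show "rdiv y x \<in> carrier X" "rdiv y x \<star> y = x"
    using inv_into_into f_inv_into_f by (metis, metis right_translation_def)
qed

text \<open>The sum of \<open>a\<close> and \<open>b\<close> has \<open>a * b\<close> as its midpoint with the origin \<open>e\<close>.\<close>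
definition pointed_group :: "'a \<Rightarrow> 'a ring" where
  "pointed_group e = \<lparr>carrier = carrier X, monoid.mult = undefined, one = undefined,
     zero = e, add = (\<lambda>a b. rdiv e (a \<star> b))\<rparr>"

definition pointed_module :: "'a \<Rightarrow> (rat, 'a) module" where
  "pointed_module e = \<lparr>carrier = carrier X, monoid.mult = undefined, one = undefined,
     zero = e, add = (\<lambda>a b. rdiv e (a \<star> b)), smult = dyadic_action (pointed_group e)\<rparr>"

lemma pointed_add:
  assumes "e \<in> carrier X" "a \<in> carrier X" "b \<in> carrier X"
  shows "rdiv e (a \<star> b) \<in> carrier X" "rdiv e (a \<star> b) \<star> e = a \<star> b"
  using assms by (auto intro!: rdiv mop_closed)

lemma pointed_addI:
  assumes "e \<in> carrier X" "a \<in> carrier X" "b \<in> carrier X" "c \<in> carrier X" "c \<star> e = a \<star> b"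
  shows "rdiv e (a \<star> b) = c"
  using assms pointed_add right_cancel by metis

text \<open>Applying \<open>t \<mapsto> t * e\<close> twice to \<open>(x + y) + z\<close> gives \<open>(x * y) * (z * e)\<close> by right
  distributivity. Mediality makes this invariant under the cyclic shift of \<open>x\<close>, \<open>y\<close>, \<open>z\<close>, which for
  a commutative addition is associativity.\<close>
lemma pointed_add_assoc:
  assumes X: "e \<in> carrier X" "a \<in> carrier X" "b \<in> carrier X" "c \<in> carrier X"
  shows "rdiv e (rdiv e (a \<star> b) \<star> c) = rdiv e (a \<star> rdiv e (b \<star> c))"
proof -
  have twice: "(rdiv e (rdiv e (x \<star> y) \<star> z) \<star> e) \<star> e = (x \<star> y) \<star> (z \<star> e)"
    if "x \<in> carrier X" "y \<in> carrier X" "z \<in> carrier X" for x y z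
    using that X(1) by (simp add: pointed_add right_distrib[of e])
  have 1: "(rdiv e (rdiv e (a \<star> b) \<star> c) \<star> e) \<star> e = (rdiv e (rdiv e (b \<star> c) \<star> a) \<star> e) \<star> e"
    using X medial_law[of b a c e] comm[of a b] by (simp only: twice)
  have "rdiv e (rdiv e (a \<star> b) \<star> c) = rdiv e (rdiv e (b \<star> c) \<star> a)"
    using 1 X by (metis right_cancel pointed_add(1) mop_closed)
  also have "\<dots> = rdiv e (a \<star> rdiv e (b \<star> c))"
    using X comm[of a "rdiv e (b \<star> c)"] pointed_add(1) by simp
  finally show ?thesis .
qed

text \<open>The negative of \<open>x\<close> is the element whose midpoint
  with \<open>x\<close> is \<open>e\<close>. By idempotence \<open>(x + x) * e = x\<close>, so halving is \<open>x \<mapsto> x * e\<close>.\<close>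
lemma pointed_group:
  assumes e: "e \<in> carrier X"
  shows "uniquely_2_divisible_group (pointed_group e)"
proof (intro uniquely_2_divisible_group.intro uniquely_2_divisible_group_axioms.intro)
  show "abelian_group (pointed_group e)"
  proof (rule abelian_groupI; simp add: pointed_group_def e)
    show "rdiv e (x \<star> y) \<in> carrier X" if "x \<in> carrier X" "y \<in> carrier X" for x y
      using pointed_add e that by blast
    show "rdiv e (rdiv e (x \<star> y) \<star> z) = rdiv e (x \<star> rdiv e (y \<star> z))"
      if "x \<in> carrier X" "y \<in> carrier X" "z \<in> carrier X" for x y z
      using pointed_add_assoc e that by blast
    show "rdiv e (x \<star> y) = rdiv e (y \<star> x)" if "x \<in> carrier X" "y \<in> carrier X" for x y
      using comm that by simp
    show "rdiv e (e \<star> x) = x" if "x \<in> carrier X" for x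
      using comm e that by (intro pointed_addI) auto
    show "\<exists>y\<in>carrier X. rdiv e (y \<star> x) = e" if "x \<in> carrier X" for x
      using e that rdiv[of e x] idem[of e] by (intro bexI[of _ "rdiv x e"] pointed_addI) auto
  qed
  show "bij_betw (\<lambda>x. x \<oplus>\<^bsub>pointed_group e\<^esub> x) (carrier (pointed_group e)) (carrier (pointed_group e))"
  proof (simp add: pointed_group_def, rule bij_betw_byWitness[of _ "\<lambda>x. x \<star> e"])
    show "\<forall>x\<in>carrier X. rdiv e (x \<star> x) \<star> e = x"
      using rdiv(2) e idem by simp
    show "\<forall>x\<in>carrier X. rdiv e ((x \<star> e) \<star> (x \<star> e)) = x"
      using e idem mop_closed by (auto intro!: pointed_addI)
  qed (use pointed_add(1) e mop_closed in auto)
qed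

lemma carrier_pointed_module: "carrier (pointed_module e) = carrier X"
  by (simp add: pointed_module_def)

lemma dyadic_pointed_module:
  assumes e: "e \<in> carrier X"
  shows "dyadic_module (pointed_module e)"
  unfolding dyadic_module_def
  by (rule uniquely_2_divisible_group.module_of_dyadic_action[OF pointed_group[OF e]])
     (simp_all add: pointed_module_def pointed_group_def)

lemma midpoint_pointed_module:
  assumes e: "e \<in> carrier X" and X: "a \<in> carrier X" "b \<in> carrier X"
  shows "(1/2) \<odot>\<^bsub>pointed_module e\<^esub> (a \<oplus>\<^bsub>pointed_module e\<^esub> b) = a \<star> b"
proof -
  interpret G: uniquely_2_divisible_group "pointed_group e" by (rule pointed_group[OF e])
  have ab: "a \<star> b \<in> carrier X" using X mop_closed by blast
  have carr: "carrier (pointed_group e) = carrier X" by (simp add: pointed_group_def)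
  have "[(1 + 1 :: int)] \<cdot>\<^bsub>pointed_group e\<^esub> (a \<star> b) = (a \<star> b) \<oplus>\<^bsub>pointed_group e\<^esub> (a \<star> b)"
    using ab by (simp only: G.int_mult_add G.int_mult_one carr)
  also have "\<dots> = a \<oplus>\<^bsub>pointed_group e\<^esub> b"
    using ab idem by (simp add: pointed_group_def)
  also have "\<dots> = [(1 :: int)] \<cdot>\<^bsub>pointed_group e\<^esub> (a \<oplus>\<^bsub>pointed_group e\<^esub> b)"
    using X G.a_closed[of a b] by (simp add: G.int_mult_one carr)
  finally have "dyadic_action (pointed_group e) (of_int 1 / 2 ^ 1) (a \<oplus>\<^bsub>pointed_group e\<^esub> b) = a \<star> b"
    using ab X G.a_closed[of a b] by (intro G.dyadic_action_eqI) (simp_all add: carr)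
  then show ?thesis by (simp add: pointed_module_def pointed_group_def)
qed

text \<open>Both rack operations are linear in terms of the module: \<open>x * y\<close> is the midpoint, and the
  inverse of the right translation by \<open>y\<close> sends \<open>x\<close> to \<open>2 x - y\<close>.\<close>
lemma rack_generated_subset_span:
  assumes e: "e \<in> carrier X" and xs: "set xs \<subseteq> carrier X"
  shows "rack_generated X (set xs) \<subseteq> dyadic_module.span (pointed_module e) xs"
proof
  interpret M: dyadic_module "pointed_module e" by (rule dyadic_pointed_module[OF e])
  have xsM: "set xs \<subseteq> carrier (pointed_module e)" using xs by (simp add: carrier_pointed_module)
  have inX: "v \<in> carrier X" if "v \<in> M.span xs" for v
    using M.span_closed[OF xsM that] by (simp add: carrier_pointed_module)
  fix v assume "v \<in> rack_generated X (set xs)"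
  then show "v \<in> M.span xs"
  proof induction
    case (incl x)
    then show ?case by (rule M.in_span[OF xsM])
  next
    case (op x y)
    have "(1/2) \<odot>\<^bsub>pointed_module e\<^esub> (x \<oplus>\<^bsub>pointed_module e\<^esub> y) \<in> M.span xs"
      using op by (intro M.span_smult M.span_add xsM dyadic_half)
    then show ?case using op inX midpoint_pointed_module[OF e] by metis
  next
    case (inv_op x y)
    define z where "z = 2 \<odot>\<^bsub>pointed_module e\<^esub> x \<oplus>\<^bsub>pointed_module e\<^esub> (-1) \<odot>\<^bsub>pointed_module e\<^esub> y"
    have D: "2 \<in> carrier dyadic_ring" "-1 \<in> carrier dyadic_ring" "1 \<in> carrier dyadic_ring"
      using dyadic_of_int[of 2] dyadic_of_int[of "-1"] dyadic_of_int[of 1] by simp_all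
    have z: "z \<in> M.span xs"
      unfolding z_def using inv_op D by (intro M.span_smult M.span_add xsM)
    have x: "x \<in> carrier (pointed_module e)" and y: "y \<in> carrier (pointed_module e)"
      using inv_op M.span_closed[OF xsM] by auto
    have "z \<oplus>\<^bsub>pointed_module e\<^esub> y = 2 \<odot>\<^bsub>pointed_module e\<^esub> x \<oplus>\<^bsub>pointed_module e\<^esub>
        ((-1) \<odot>\<^bsub>pointed_module e\<^esub> y \<oplus>\<^bsub>pointed_module e\<^esub> 1 \<odot>\<^bsub>pointed_module e\<^esub> y)"
      unfolding z_def using x y D by (simp add: M.one_smult M.M.a_assoc)
    also have "\<dots> = 2 \<odot>\<^bsub>pointed_module e\<^esub> x"
      using x y D by (subst M.smult_add[symmetric]) (simp_all add: M.zero_smult)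
    finally have "z \<star> y = (1/2) \<odot>\<^bsub>pointed_module e\<^esub> (2 \<odot>\<^bsub>pointed_module e\<^esub> x)"
      using midpoint_pointed_module[OF e, of z y] z inv_op inX by simp
    also have "\<dots> = x" using x D dyadic_half by (simp add: M.smult_smult M.one_smult)
    finally have "rdiv y x = z"
      using rdiv[of x y] right_cancel[of "rdiv y x" y z] inX z inv_op by simp
    then show ?case using z by simp
  qed
qed

end

section \<open>Classification by cyclic modules\<close>

definition dyadic_line :: "rat magma" where
  "dyadic_line = \<lparr>carrier = carrier dyadic_ring, mop = (\<lambda>x y. 1/2 * (x + y))\<rparr>"

lemma magma_dyadic_line: "magma dyadic_line"
  using dyadic_mult[OF dyadic_half dyadic_add] by (auto simp: magma_def dyadic_line_def)

lemma midpoint_dyadic_free_module: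
  "midpoint_quandle (dyadic_free_module r) = direct_sum {1..r} (\<lambda>_. dyadic_line)"
  by (auto simp: midpoint_quandle_def dyadic_free_module_def direct_sum_def dyadic_line_def
      fun_eq_iff)

lemma cyclic_midpoint_quandle_simps:
  "carrier (cyclic_midpoint_quandle N) = {0..<int N}"
  "odd N \<Longrightarrow> u \<star>\<^bsub>cyclic_midpoint_quandle N\<^esub> v = ((int N + 1) div 2 * ((u + v) mod int N)) mod int N"
  using dyadic_residue_smult[of N 1 1]
  by (auto simp: cyclic_midpoint_quandle_def midpoint_quandle_def dyadic_residue_module_def residue_ring_def)

lemma magma_cyclic_midpoint_quandle: "odd N \<Longrightarrow> magma (cyclic_midpoint_quandle N)"
  by (auto simp: magma_def cyclic_midpoint_quandle_simps odd_pos)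

abbreviation standard_quandle :: "nat \<Rightarrow> nat \<Rightarrow> (nat \<Rightarrow> nat) \<Rightarrow> ((nat \<Rightarrow> rat) \<times> (nat \<Rightarrow> int)) magma" where
  "standard_quandle r n m \<equiv> direct_sum2 (midpoint_quandle (dyadic_free_module r))
     (direct_sum {1..n} (\<lambda>i. cyclic_midpoint_quandle (2 * m i + 1)))"

lemma standard_quandle_Suc_free:
  "rack_isomorphic (direct_sum2 dyadic_line (standard_quandle r n m)) (standard_quandle (Suc r) n m)"
proof -
  have "rack_isomorphic (direct_sum2 dyadic_line (direct_sum {1..r} (\<lambda>_. dyadic_line)))
      (direct_sum (insert (Suc r) {1..r}) (\<lambda>_. dyadic_line))"
    using direct_sum_insert[of "Suc r" "{1..r}" "\<lambda>_. dyadic_line"] by simp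
  then have "rack_isomorphic (direct_sum2 dyadic_line (midpoint_quandle (dyadic_free_module r)))
      (midpoint_quandle (dyadic_free_module (Suc r)))"
    by (simp only: midpoint_dyadic_free_module atLeastAtMostSuc_conv le_add1 plus_1_eq_Suc le_Suc_eq)
      (simp add: atLeastAtMostSuc_conv)
  from rack_isomorphic_trans[OF direct_sum2_assoc direct_sum2_cong[OF this rack_isomorphic_refl]]
  show ?thesis .
qed

lemma standard_quandle_Suc_cyclic:
  "rack_isomorphic (direct_sum2 (cyclic_midpoint_quandle (2 * k + 1)) (standard_quandle r n m))
     (standard_quandle r (Suc n) (m(Suc n := k)))"
proof -
  let ?m = "m(Suc n := k)"
  let ?C = "\<lambda>i. cyclic_midpoint_quandle (2 * ?m i + 1)"
  have same: "direct_sum {1..n} (\<lambda>i. cyclic_midpoint_quandle (2 * m i + 1)) = direct_sum {1..n} ?C"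
    by (rule direct_sum_cong) auto
  have "rack_isomorphic (direct_sum2 (cyclic_midpoint_quandle (2 * k + 1)) (direct_sum {1..n} ?C))
      (direct_sum (insert (Suc n) {1..n}) ?C)"
    using direct_sum_insert[of "Suc n" "{1..n}" ?C] by simp
  moreover have "insert (Suc n) {1..n} = {1..Suc n}" by auto
  ultimately have "rack_isomorphic (direct_sum2 (cyclic_midpoint_quandle (2 * k + 1)) (direct_sum {1..n} ?C))
      (direct_sum {1..Suc n} ?C)" by simp
  from rack_isomorphic_trans[OF direct_sum2_left_commute direct_sum2_cong[OF rack_isomorphic_refl this]]
  show ?thesis unfolding same .
qed

context dyadic_module
begin

text \<open>The midpoint quandle of the submodule generated by \<open>xs\<close>.\<close>
definition span_quandle :: "'a list \<Rightarrow> 'a magma" where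
  "span_quandle xs = \<lparr>carrier = span xs, mop = (\<lambda>u v. (1/2) \<odot> (u \<oplus> v))\<rparr>"

lemma span_quandle_simps [simp]:
  "carrier (span_quandle xs) = span xs"
  "u \<star>\<^bsub>span_quandle xs\<^esub> v = (1/2) \<odot> (u \<oplus> v)"
  by (simp_all add: span_quandle_def)

lemma magma_span_quandle: "set xs \<subseteq> carrier M \<Longrightarrow> magma (span_quandle xs)"
  using span_smult[OF _ dyadic_half span_add] by (auto simp: magma_def)

lemma span_singleton: "x \<in> carrier M \<Longrightarrow> span [x] = (\<lambda>d. d \<odot> x) ` carrier dyadic_ring"
  by (auto simp: image_iff) (metis smult_closed r_zero)

text \<open>Subtracting the two representations puts \<open>(d - d') x\<close> into the span of \<open>ys\<close>.\<close>
lemma direct_decomposition: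
  assumes M: "x \<in> carrier M" "b \<in> span ys" "b' \<in> span ys" "set ys \<subseteq> carrier M"
    and D: "d \<in> carrier dyadic_ring" "d' \<in> carrier dyadic_ring"
    and direct: "\<And>c. \<lbrakk>c \<in> carrier dyadic_ring; c \<odot> x \<in> span ys\<rbrakk> \<Longrightarrow> c \<odot> x = \<zero>"
    and eq: "d \<odot> x \<oplus> b = d' \<odot> x \<oplus> b'"
  shows "d \<odot> x = d' \<odot> x" and "b = b'"
proof -
  have b: "b \<in> carrier M" "b' \<in> carrier M" using M span_closed by auto
  have neg: "-1 \<in> carrier dyadic_ring" "1 \<in> carrier dyadic_ring"
    using dyadic_of_int[of "-1"] dyadic_of_int[of 1] by simp_all
  have nd: "- d' \<in> carrier dyadic_ring" "d + - d' \<in> carrier dyadic_ring"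
    using D dyadic_uminus dyadic_add by blast+
  have cancel: "b \<oplus> (-1) \<odot> b = \<zero>"
    using smult_add[of 1 "-1" b] b neg by (simp add: one_smult zero_smult)
  have "(d + - d') \<odot> x \<oplus> (b \<oplus> (-1) \<odot> b) = (d' + - d') \<odot> x \<oplus> (b' \<oplus> (-1) \<odot> b)"
    using smult_add_smult_add[of d "- d'" x b "(-1) \<odot> b"]
      smult_add_smult_add[of d' "- d'" x b' "(-1) \<odot> b"] eq M(1) b D nd neg by simp
  then have diff: "(d + - d') \<odot> x = b' \<oplus> (-1) \<odot> b"
    using cancel M(1) b nd neg by (simp add: zero_smult)
  also have "\<dots> \<in> span ys" using M neg by (intro span_add span_smult)
  finally have z: "(d + - d') \<odot> x = \<zero>" by (rule direct[OF nd(2)])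
  have "d \<odot> x = ((d + - d') + d') \<odot> x" by simp
  also have "\<dots> = \<zero> \<oplus> d' \<odot> x" using smult_add[OF nd(2) D(2) M(1)] z by simp
  finally show dx: "d \<odot> x = d' \<odot> x" using M(1) D by simp
  with eq show "b = b'" using M(1) D b by simp
qed

text \<open>Addition is a bijection from the product of the two spans onto the whole span, and it preserves
  midpoints because halving is additive.\<close>
lemma span_quandle_Cons:
  assumes M: "set (x # ys) \<subseteq> carrier M"
    and direct: "\<And>c. \<lbrakk>c \<in> carrier dyadic_ring; c \<odot> x \<in> span ys\<rbrakk> \<Longrightarrow> c \<odot> x = \<zero>"
  shows "rack_isomorphic (span_quandle (x # ys)) (direct_sum2 (span_quandle [x]) (span_quandle ys))"
proof (rule rack_isomorphic_sym)
  have x: "x \<in> carrier M" and ys: "set ys \<subseteq> carrier M" using M by auto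
  show "magma (direct_sum2 (span_quandle [x]) (span_quandle ys))"
    using x ys by (intro magma_direct_sum2 magma_span_quandle) auto
  show "rack_isomorphic (direct_sum2 (span_quandle [x]) (span_quandle ys)) (span_quandle (x # ys))"
  proof (rule rack_isomorphicI[of "\<lambda>p. fst p \<oplus> snd p"])
    have "inj_on (\<lambda>p. fst p \<oplus> snd p) (span [x] \<times> span ys)"
    proof (rule inj_onI)
      fix p q assume p: "p \<in> span [x] \<times> span ys" and q: "q \<in> span [x] \<times> span ys"
        and eq: "fst p \<oplus> snd p = fst q \<oplus> snd q"
      obtain d where d: "d \<in> carrier dyadic_ring" "fst p = d \<odot> x"
        using p unfolding span_singleton[OF x] by auto
      obtain d' where d': "d' \<in> carrier dyadic_ring" "fst q = d' \<odot> x"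
        using q unfolding span_singleton[OF x] by auto
      have "fst p = fst q" "snd p = snd q"
        using direct_decomposition[OF x _ _ ys d(1) d'(1) direct, of "snd p" "snd q"] p q eq d d'
        by auto
      then show "p = q" by (simp add: prod_eq_iff)
    qed
    moreover have "(\<lambda>p. fst p \<oplus> snd p) ` (span [x] \<times> span ys) = span (x # ys)"
      unfolding span_singleton[OF x] by (force simp: image_def)
    ultimately show "bij_betw (\<lambda>p. fst p \<oplus> snd p)
        (carrier (direct_sum2 (span_quandle [x]) (span_quandle ys))) (carrier (span_quandle (x # ys)))"
      by (simp add: bij_betw_def del: span.simps)
  next
    fix p q
    assume "p \<in> carrier (direct_sum2 (span_quandle [x]) (span_quandle ys))"
      "q \<in> carrier (direct_sum2 (span_quandle [x]) (span_quandle ys))"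
    then have "fst p \<in> carrier M" "snd p \<in> carrier M" "fst q \<in> carrier M" "snd q \<in> carrier M"
      using span_closed[of "[x]"] span_closed[OF ys] x by (auto simp del: span.simps)
    then show "fst (p \<star>\<^bsub>direct_sum2 (span_quandle [x]) (span_quandle ys)\<^esub> q)
        \<oplus> snd (p \<star>\<^bsub>direct_sum2 (span_quandle [x]) (span_quandle ys)\<^esub> q)
      = (fst p \<oplus> snd p) \<star>\<^bsub>span_quandle (x # ys)\<^esub> (fst q \<oplus> snd q)"
      using dyadic_half by (simp add: smult_r_distr[symmetric] M.a_ac)
  qed
qed

lemma span_quandle_torsion_free:
  assumes x: "x \<in> carrier M"
    and free: "\<And>d. \<lbrakk>d \<in> carrier dyadic_ring; d \<odot> x = \<zero>\<rbrakk> \<Longrightarrow> d = 0"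
  shows "rack_isomorphic (span_quandle [x]) dyadic_line"
proof (rule rack_isomorphic_sym[OF rack_isomorphicI magma_dyadic_line])
  have "inj_on (\<lambda>d. d \<odot> x) (carrier dyadic_ring)"
  proof (rule inj_onI)
    fix d e assume d: "d \<in> carrier dyadic_ring" and e: "e \<in> carrier dyadic_ring"
      and eq: "d \<odot> x = e \<odot> x"
    have "(d + - e) \<odot> x = (e + - e) \<odot> x"
      using d e dyadic_uminus[OF e] x eq by (simp only: smult_add)
    then show "d = e" using free[of "d + - e"] dyadic_add[OF d dyadic_uminus[OF e]] x
      by (simp add: zero_smult)
  qed
  then show "bij_betw (\<lambda>d. d \<odot> x) (carrier dyadic_line) (carrier (span_quandle [x]))"
    using span_singleton[OF x] by (simp add: bij_betw_def dyadic_line_def del: span.simps)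
next
  fix d e assume "d \<in> carrier dyadic_line" "e \<in> carrier dyadic_line"
  then show "(d \<star>\<^bsub>dyadic_line\<^esub> e) \<odot> x = (d \<odot> x) \<star>\<^bsub>span_quandle [x]\<^esub> (e \<odot> x)"
    using x dyadic_half dyadic_add[of d e] smult_smult[of "1/2" "d + e" x]
    by (simp add: dyadic_line_def smult_add[symmetric])
qed

lemma smult_cong_torsion:
  assumes x: "x \<in> carrier M" and N: "of_int N \<odot> x = \<zero>" and "[a = b] (mod N)"
  shows "of_int a \<odot> x = of_int b \<odot> x"
proof -
  obtain k where k: "a = b + k * N" using assms(3) by (metis cong_iff_lin cong_sym mult.commute)
  have "of_int a \<odot> x = of_int b \<odot> x \<oplus> of_int k \<odot> (of_int N \<odot> x)"
    unfolding k of_int_add of_int_mult using x by (simp only: smult_add smult_smult dyadic_of_int dyadic_mult)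
  then show ?thesis using N x dyadic_of_int by simp
qed

lemma dyadic_smult_eqI:
  assumes "x \<in> carrier M" "y \<in> carrier M" "2 ^ k \<odot> y = of_int a \<odot> x"
  shows "(of_int a / 2 ^ k) \<odot> x = y"
proof -
  have "(of_int a / 2 ^ k) \<odot> x = (1 / 2 ^ k) \<odot> (of_int a \<odot> x)"
    using assms(1) dyadic_pow2(2) dyadic_of_int by (simp add: smult_smult)
  also have "\<dots> = (1 / 2 ^ k * 2 ^ k) \<odot> y"
    using assms(2,3) dyadic_pow2 by (metis smult_smult)
  finally show ?thesis using assms(2) by (simp add: one_smult)
qed

text \<open>Every dyadic multiple of \<open>x\<close> is already an integer multiple, since 2 has the inverse
  \<open>(N + 1) / 2\<close> modulo the odd number \<open>N\<close>; so residues modulo \<open>N\<close> parametrise the span.\<close>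
lemma span_quandle_torsion:
  assumes x: "x \<in> carrier M" and N: "odd N" and tors: "of_int (int N) \<odot> x = \<zero>"
    and order: "\<And>a. of_int a \<odot> x = \<zero> \<Longrightarrow> int N dvd a"
  shows "rack_isomorphic (span_quandle [x]) (cyclic_midpoint_quandle N)"
proof (rule rack_isomorphic_sym[OF rack_isomorphicI magma_cyclic_midpoint_quandle[OF N]])
  define h where "h = (int N + 1) div 2"
  have h: "[2 * h = 1] (mod int N)" unfolding h_def by (rule cong_two_mult_half[OF N])
  have N0: "0 < int N" using odd_pos[OF N] by simp
  have "inj_on (\<lambda>a. of_int a \<odot> x) {0..<int N}"
  proof (rule inj_onI)
    fix a b :: int assume a: "a \<in> {0..<int N}" and b: "b \<in> {0..<int N}"
      and eq: "of_int a \<odot> x = of_int b \<odot> x"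
    have "of_int (a + - b) \<odot> x = of_int (b + - b) \<odot> x"
      using x eq by (simp only: of_int_add smult_add dyadic_of_int)
    then have "int N dvd a - b" using order[of "a + - b"] x by (simp add: zero_smult)
    then show "a = b" using a b by (simp add: mod_eq_dvd_iff[symmetric])
  qed
  moreover have "(\<lambda>a. of_int a \<odot> x) ` {0..<int N} = span [x]"
  proof (intro subset_antisym subsetI)
    fix v assume "v \<in> span [x]"
    then obtain a k where v: "v = (of_int a / 2 ^ k) \<odot> x"
      unfolding span_singleton[OF x] using dyadic_carrier_iff by auto
    \<comment> \<open>As \<open>h\<close> inverts 2 modulo \<open>N\<close>, this \<open>b\<close> is the residue of \<open>a / 2 ^ k\<close>.\<close>
    define b where "b = (h ^ k * a) mod int N"
    have "[(2 * h) ^ k * a = 1 ^ k * a] (mod int N)" by (intro cong_mult cong_pow h cong_refl)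
    then have "[2 ^ k * b = a] (mod int N)"
      unfolding b_def by (simp add: cong_def mod_simps power_mult_distrib mult.assoc)
    then have "of_int (2 ^ k * b) \<odot> x = of_int a \<odot> x" by (rule smult_cong_torsion[OF x tors])
    then have "2 ^ k \<odot> (of_int b \<odot> x) = of_int a \<odot> x"
      using x dyadic_pow2 dyadic_of_int by (simp add: smult_smult)
    then have "v = of_int b \<odot> x" unfolding v using x dyadic_of_int by (intro dyadic_smult_eqI) auto
    moreover have "b \<in> {0..<int N}" unfolding b_def using N0 by simp
    ultimately show "v \<in> (\<lambda>a. of_int a \<odot> x) ` {0..<int N}" by blast
  qed (use span_singleton[OF x] dyadic_of_int in auto)
  ultimately show "bij_betw (\<lambda>a. of_int a \<odot> x) (carrier (cyclic_midpoint_quandle N)) (carrier (span_quandle [x]))"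
    by (simp add: bij_betw_def cyclic_midpoint_quandle_simps del: span.simps)
  fix a b assume "a \<in> carrier (cyclic_midpoint_quandle N)" "b \<in> carrier (cyclic_midpoint_quandle N)"
  let ?c = "a \<star>\<^bsub>cyclic_midpoint_quandle N\<^esub> b"
  have "[(2 * h) * (a + b) = 1 * (a + b)] (mod int N)" by (intro cong_mult h cong_refl)
  then have "[2 * ?c = a + b] (mod int N)"
    unfolding cyclic_midpoint_quandle_simps(2)[OF N] h_def[symmetric]
    by (simp add: cong_def mod_simps mult.assoc)
  then have "of_int (2 * ?c) \<odot> x = of_int (a + b) \<odot> x" by (rule smult_cong_torsion[OF x tors])
  then have "2 ^ 1 \<odot> (of_int ?c \<odot> x) = of_int (a + b) \<odot> x"
    using x dyadic_of_int[of 2] dyadic_of_int by (simp add: smult_smult)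
  then have "(of_int (a + b) / 2 ^ 1) \<odot> x = of_int ?c \<odot> x"
    using x dyadic_of_int by (intro dyadic_smult_eqI) auto
  moreover have "(of_int (a + b) / 2 ^ 1) \<odot> x = (1/2) \<odot> (of_int a \<odot> x \<oplus> of_int b \<odot> x)"
    using x dyadic_of_int dyadic_half dyadic_add[OF dyadic_of_int dyadic_of_int, of a b]
    by (simp add: smult_add[symmetric] smult_smult)
  ultimately show "of_int ?c \<odot> x = (of_int a \<odot> x) \<star>\<^bsub>span_quandle [x]\<^esub> (of_int b \<odot> x)" by simp
qed

text \<open>The order of a torsion element is odd: from \<open>2 n x = 0\<close> follows \<open>n x = 0\<close>, contrary to
  minimality of the order \<open>2 n\<close>.\<close>
lemma span_quandle_cyclic:
  assumes x: "x \<in> carrier M"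
  shows "rack_isomorphic (span_quandle [x]) dyadic_line
    \<or> (\<exists>m. rack_isomorphic (span_quandle [x]) (cyclic_midpoint_quandle (2 * m + 1)))"
proof (cases "\<exists>n>0. of_nat n \<odot> x = \<zero>")
  case True
  define N where "N = (LEAST n. 0 < n \<and> of_nat n \<odot> x = \<zero>)"
  have N0: "0 < N" and Nx: "of_nat N \<odot> x = \<zero>"
    using LeastI_ex[OF True[unfolded Bex_def]] unfolding N_def by auto
  have least: "of_nat n \<odot> x \<noteq> \<zero>" if "0 < n" "n < N" for n
    using not_less_Least[of n] that unfolding N_def by blast
  have tors: "of_int (int N) \<odot> x = \<zero>" using Nx by simp
  have "odd N"
  proof
    assume "even N"
    then obtain n where n: "N = 2 * n" by blast
    have "2 ^ 1 \<odot> (of_int (int n) \<odot> x) = of_int 0 \<odot> x"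
      using Nx x dyadic_of_int[of 2] dyadic_of_int[of "int n"] unfolding n
      by (simp add: smult_smult zero_smult)
    then have "(of_int 0 / 2 ^ 1) \<odot> x = of_int (int n) \<odot> x"
      using x dyadic_of_int[of "int n"] by (intro dyadic_smult_eqI) auto
    then have "of_nat n \<odot> x = \<zero>" using x by (simp add: zero_smult)
    with least[of n] N0 n show False by simp
  qed
  moreover have "int N dvd a" if a: "of_int a \<odot> x = \<zero>" for a
  proof -
    have "[a mod int N = a] (mod int N)" by (simp add: cong_def)
    then have "of_int (a mod int N) \<odot> x = \<zero>" using smult_cong_torsion[OF x tors] a by metis
    moreover have "0 \<le> a mod int N" "a mod int N < int N" using N0 by auto
    ultimately have "a mod int N = 0"
      using least[of "nat (a mod int N)"] by (cases "a mod int N = 0") (auto simp: nat_less_iff)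
    then show ?thesis by (simp add: dvd_eq_mod_eq_0)
  qed
  ultimately have "rack_isomorphic (span_quandle [x]) (cyclic_midpoint_quandle N)"
    using span_quandle_torsion[OF x _ tors] by blast
  moreover obtain m where "N = 2 * m + 1" using \<open>odd N\<close> by (rule oddE)
  ultimately show ?thesis by blast
next
  case False
  have "d = 0" if d: "d \<in> carrier dyadic_ring" and dx: "d \<odot> x = \<zero>" for d
  proof (rule ccontr)
    assume "d \<noteq> 0"
    obtain a k where dk: "d = of_int a / 2 ^ k" using d dyadic_carrier_iff by metis
    have "a \<noteq> 0" using \<open>d \<noteq> 0\<close> dk by auto
    have ax: "of_int a \<odot> x = \<zero>" using dx smult_in_span_denominator(2)[of "[]" x a k] x dk by simp
    have "of_int (\<bar>a\<bar>) \<odot> x = of_int (sgn a) \<odot> (of_int a \<odot> x)"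
      using x dyadic_of_int by (simp only: smult_smult flip: of_int_mult) (simp add: abs_sgn mult.commute)
    then have "of_int \<bar>a\<bar> \<odot> x = \<zero>" using ax dyadic_of_int by (simp del: of_int_abs)
    moreover have "(of_int \<bar>a\<bar> :: rat) = of_nat (nat \<bar>a\<bar>)" by (simp add: of_nat_nat)
    ultimately have "of_nat (nat \<bar>a\<bar>) \<odot> x = \<zero>" by metis
    moreover have "0 < nat \<bar>a\<bar>" using \<open>a \<noteq> 0\<close> by simp
    ultimately show False using False by blast
  qed
  then show ?thesis using span_quandle_torsion_free[OF x] by blast
qed

text \<open>By independence the generators can be split off one at a time, each contributing one coordinate
  to the free part or to the torsion part of the standard quandle.\<close>
theorem independent_span_quandle:
  assumes "set ys \<subseteq> carrier M" "independent ys"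
  shows "\<exists>r n m. rack_isomorphic (span_quandle ys) (standard_quandle r n m)"
  using assms
proof (induction ys)
  case Nil
  \<comment> \<open>The only extensional function on an empty index set is \<open>undefined\<close> everywhere.\<close>
  have "rack_isomorphic (span_quandle []) (standard_quandle 0 0 (\<lambda>_. 0))"
    by (rule rack_isomorphicI[of "\<lambda>_. (\<lambda>_. undefined, \<lambda>_. undefined)"])
       (auto simp: bij_betw_def midpoint_dyadic_free_module)
  then show ?case by (intro exI)
next
  case (Cons x ys)
  then obtain r n m where IH: "rack_isomorphic (span_quandle ys) (standard_quandle r n m)" by auto
  have x: "x \<in> carrier M" using Cons.prems by simp
  have split: "rack_isomorphic (span_quandle (x # ys)) (direct_sum2 (span_quandle [x]) (span_quandle ys))"
    using Cons.prems by (intro span_quandle_Cons) auto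
  from span_quandle_cyclic[OF x] show ?case
  proof (elim disjE exE)
    assume "rack_isomorphic (span_quandle [x]) dyadic_line"
    from rack_isomorphic_trans[OF split rack_isomorphic_trans[OF direct_sum2_cong[OF this IH]
        standard_quandle_Suc_free]]
    show ?thesis by blast
  next
    fix k assume "rack_isomorphic (span_quandle [x]) (cyclic_midpoint_quandle (2 * k + 1))"
    from rack_isomorphic_trans[OF split rack_isomorphic_trans[OF direct_sum2_cong[OF this IH]
        standard_quandle_Suc_cyclic]]
    show ?thesis by blast
  qed
qed

lemma midpoint_quandle_medial_commutative:
  "medial (midpoint_quandle M)" "commutative (midpoint_quandle M)"
  using dyadic_half
  by (auto simp: medial_def commutative_def midpoint_quandle_def smult_r_distr[symmetric] M.a_ac)

end

lemma standard_quandle_medial_commutative: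
  "medial (standard_quandle r n m)" "commutative (standard_quandle r n m)"
proof -
  have free: "dyadic_module (dyadic_free_module r)"
    unfolding dyadic_module_def by (rule module_dyadic_free_module)
  have cyc: "dyadic_module (dyadic_residue_module (2 * m i + 1))" for i
    unfolding dyadic_module_def by (rule module_dyadic_residue_module) simp
  note * = dyadic_module.midpoint_quandle_medial_commutative
  show "medial (standard_quandle r n m)" "commutative (standard_quandle r n m)"
    unfolding cyclic_midpoint_quandle_def using *[OF free] *[OF cyc]
    by (blast intro: medial_direct_sum2 medial_direct_sum commutative_direct_sum2 commutative_direct_sum)+
qed

context medial_commutative_rack
begin

theorem finitely_generated_imp_standard:
  assumes "carrier X \<noteq> {}" "finitely_generated_rack X"
  shows "\<exists>r n m. rack_isomorphic X (standard_quandle r n m)"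
proof -
  obtain e where e: "e \<in> carrier X" using assms(1) by blast
  obtain S where S: "finite S" "S \<subseteq> carrier X" "rack_generated X S = carrier X"
    using assms(2) unfolding finitely_generated_rack_def by blast
  obtain xs where xs: "set xs = S" using finite_list[OF S(1)] by blast
  interpret M: dyadic_module "pointed_module e" by (rule dyadic_pointed_module[OF e])
  have xsM: "set xs \<subseteq> carrier (pointed_module e)" using xs S(2) by (simp add: carrier_pointed_module)
  obtain ys where ys: "set ys \<subseteq> carrier (pointed_module e)" "M.independent ys" "M.span ys = M.span xs"
    using M.exists_independent_generators[OF xsM] by blast
  have "carrier X \<subseteq> M.span xs" using rack_generated_subset_span[OF e, of xs] S(2,3) xs by simp
  then have span: "M.span ys = carrier X"
    using M.span_closed[OF ys(1)] ys(3) by (auto simp: carrier_pointed_module)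
  have "rack_isomorphic X (M.span_quandle ys)"
    by (rule rack_isomorphicI[of id]) (simp_all add: span midpoint_pointed_module[OF e])
  with M.independent_span_quandle[OF ys(1,2)] show ?thesis
    using rack_isomorphic_trans by blast
qed

end

text \<open>The carrier is closed under the inverse operations too, so it is the rack generated by itself.\<close>
lemma finite_rack_finitely_generated:
  assumes "rack X" "finite (carrier X)"
  shows "finitely_generated_rack X"
proof -
  have "rack_generated X (carrier X) \<subseteq> carrier X"
  proof
    fix v assume "v \<in> rack_generated X (carrier X)"
    then show "v \<in> carrier X"
    proof induction
      case (op x y)
      then show ?case using assms(1) by (meson magma.mop_closed rack.axioms(1))
    next
      case (inv_op x y)
      have "right_translation X y ` carrier X = carrier X"
        using rack.right_translation_auto[OF assms(1) inv_op.IH(2)]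
        unfolding magma_iso_def bij_betw_def by blast
      then show ?case using inv_op.IH(1) inv_into_into by metis
    qed
  qed
  then have "rack_generated X (carrier X) = carrier X"
    by (auto intro: rack_generated.incl)
  then show ?thesis unfolding finitely_generated_rack_def using assms(2) by blast
qed

text \<open>If there is at least one coordinate, the constant integer vectors are pairwise distinct.\<close>
lemma finite_free_midpoint_quandle:
  assumes "finite (carrier (midpoint_quandle (dyadic_free_module r)))"
  shows "r = 0"
proof (rule ccontr)
  assume "r \<noteq> 0"
  then have inj: "inj (\<lambda>a::int. \<lambda>i\<in>{1..r}. (of_int a :: rat))"
    by (auto simp: inj_on_def fun_eq_iff restrict_def split: if_splits dest!: spec[of _ 1])
  have "range (\<lambda>a::int. \<lambda>i\<in>{1..r}. (of_int a :: rat)) \<subseteq> carrier (midpoint_quandle (dyadic_free_module r))"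
    using dyadic_of_int by (auto simp: midpoint_dyadic_free_module dyadic_line_def)
  then have "finite (range (\<lambda>a::int. \<lambda>i\<in>{1..r}. (of_int a :: rat)))"
    using assms finite_subset by blast
  then show False using finite_imageD[OF _ inj] infinite_UNIV_int by blast
qed

text \<open>Since the torsion part is nonempty, finiteness of the product forces the free part to be finite,
  and then it has rank 0 and a single element.\<close>
lemma finite_standard_quandle:
  assumes iso: "rack_isomorphic X (standard_quandle r n m)"
    and "finite (carrier X)" "carrier X \<noteq> {}"
  shows "rack_isomorphic X (direct_sum {1..n} (\<lambda>i. cyclic_midpoint_quandle (2 * m i + 1)))"
proof -
  let ?F = "midpoint_quandle (dyadic_free_module r)"
  let ?T = "direct_sum {1..n} (\<lambda>i. cyclic_midpoint_quandle (2 * m i + 1))"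
  obtain h where h: "bij_betw h (carrier X) (carrier ?F \<times> carrier ?T)"
    using iso by (rule rack_isomorphicE) simp
  have "finite (carrier ?F \<times> carrier ?T)" using bij_betw_finite[OF h] assms(2) by simp
  moreover have "carrier ?T \<noteq> {}" using h assms(3) by (auto simp: bij_betw_def)
  ultimately have "finite (carrier ?F)" by (rule finite_cartesian_productD1)
  then have "r = 0" by (rule finite_free_midpoint_quandle)
  then have "carrier ?F = {\<lambda>_. undefined}" by (simp add: midpoint_dyadic_free_module)
  from rack_isomorphic_trans[OF iso rack_isomorphic_unit_direct_sum2[OF this]] show ?thesis .
qed

theorem theorem6p4:
  fixes X :: "('a, 'b) magma_scheme"
  assumes "rack X" and "carrier X \<noteq> {}"
  shows "(finitely_generated_rack X \<longrightarrow>
            (medial X \<and> commutative X \<longleftrightarrow>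
              (\<exists>(r::nat) (n::nat) (m :: nat \<Rightarrow> nat).
                 rack_isomorphic X
                   (direct_sum2 (midpoint_quandle (dyadic_free_module r))
                      (direct_sum {1..n} (\<lambda>i. cyclic_midpoint_quandle (2 * m i + 1)))))))
       \<and> (finite (carrier X) \<and> medial X \<and> commutative X \<longrightarrow>
            (\<exists>(n::nat) (m :: nat \<Rightarrow> nat).
               rack_isomorphic X (direct_sum {1..n} (\<lambda>i. cyclic_midpoint_quandle (2 * m i + 1)))))"
proof -
  have standard: "\<exists>r n m. rack_isomorphic X (standard_quandle r n m)"
    if "finitely_generated_rack X" "medial X" "commutative X"
  proof -
    interpret medial_commutative_rack X
      using assms(1) that(2,3) by (intro medial_commutative_rack.intro medial_commutative_rack_axioms.intro)
    show ?thesis using finitely_generated_imp_standard[OF assms(2) that(1)] .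
  qed
  have "medial X \<and> commutative X" if "rack_isomorphic X (standard_quandle r n m)" for r n m
    using medial_commutative_transfer[OF that rack.axioms(1)[OF assms(1)]]
      standard_quandle_medial_commutative by blast
  moreover have "\<exists>(n::nat) (m :: nat \<Rightarrow> nat). rack_isomorphic X (direct_sum {1..n} (\<lambda>i. cyclic_midpoint_quandle (2 * m i + 1)))"
    if fin: "finite (carrier X)" and "medial X" "commutative X"
  proof -
    obtain r n m where "rack_isomorphic X (standard_quandle r n m)"
      using standard[OF finite_rack_finitely_generated[OF assms(1) fin]] \<open>medial X\<close> \<open>commutative X\<close>
      by auto
    from finite_standard_quandle[OF this fin assms(2)] show ?thesis by (intro exI)
  qed
  ultimately show ?thesis using standard by blast
qed

end
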